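(* Let $G=N\rtimes Q$, $H=M\rtimes R$, where $M$ is a normal subgroup of $N$ and $R$ is a subgroup of $Q$ which normalizes $M$, and assume that $(G,H)$ is a reduced Hecke pair with Schlichting completion $(\bar G,\bar H)$. With $\mathcal E$, $\mathcal F$, $M_E$, $R^E_F$ as defined in the context, and closures taken in $\bar G$, we have: (i) $\bar M=\varprojlim_{E\in\mathcal E}M/M_E$; (ii) $\bar N=\varprojlim_{E\in\mathcal E}N/M_E$; (iii) $\bar R=\varprojlim_{(E,F)\in\mathcal F}R/R^E_F$; (iv) $\bar H=\varprojlim_{(E,F)\in\mathcal F}\bigl(M/M_E\rtimes R/R^E_F\bigr)$, all as topological groups.
   Context: $G=N\rtimes Q$ is an internal semidirect product of a normal subgroup $N$ by a subgroup $Q$ (so $N\cap Q=\{e\}$, $NQ=G$), and $H=MR$. A Hecke pair $(G,H)$ is a group $G$ with a subgroup $H$ such that every double coset $HxH$ is a finite union of left cosets; it is reduced if $\bigcap_{x\in G}xHx^{-1}=\{e\}$. The Hecke topology on $G$ is the group topology with $\{xHx^{-1}\mid x\in G\}$ a local subbase of neighborhoods of $e$. The Schlichting completion $(\bar G,\bar H)$ of a reduced Hecke pair consists of the completion $\bar G$ of $G$ in the two-sided uniformity of the Hecke topology and the closure $\bar H$ of $H$ in $\bar G$; $\bar G$ is locally compact Hausdorff and $\bar H$ is compact open. Notation. For $q\in Q$, $M_q=M\cap qMq^{-1}$, and for $E\subset Q$, $M_E=\bigcap_{q\in E}M_q$. For $n\in N$, $R_{n,M}=\{r\in R\mid rnMr^{-1}=nM\}$,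 and for $F\subset N$, $R_{F,M}=\bigcap_{n\in F}R_{n,M}$. For $E\subset Q$ and $F\subset N$, $$R^E_F=\bigcap_{q\in E}qR_{F,M}q^{-1}\cap R=\bigcap_{q\in E}\bigcap_{n\in F}qR_{n,M}q^{-1}\cap R.$$ $\mathcal E$ is the family of all subsets $E\subset Q$ such that $E$ is a finite union of cosets in $Q/R$, $e\in E$, and $RE=E$. $\mathcal F$ is the family of all pairs $(E,F)$ such that $E\in\mathcal E$, $F\subset N$ is a finite union of cosets in $N/M$, and $q^{-1}Mq\subset F$ for all $q\in E$. The index sets are ordered by inclusion. For $E\in\mathcal E$ and $(E,F)\in\mathcal F$, $M_E$ is normal in $N$, in $M$ and in $H$, $R^E_F$ is normal in $R$, $M_ER^E_F$ is normal in $H$, and $H/(M_ER^E_F)\cong M/M_E\rtimes R/R^E_F$; the quotient groups carry the discrete topology. *)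

theory Defs
  imports "HOL-Analysis.Analysis" "HOL-Algebra.Product_Groups" "HOL-Library.Product_Order"
begin

section \<open>Topological groups, inverse limits and semidirect products\<close>

definition topological_group :: "('a, 'm) monoid_scheme \<Rightarrow> 'a topology \<Rightarrow> bool" where
  "topological_group G T \<longleftrightarrow> group G \<and> topspace T = carrier G \<and>
     continuous_map (prod_topology T T) T (\<lambda>(x, y). x \<otimes>\<^bsub>G\<^esub> y) \<and>
     continuous_map T T (\<lambda>x. inv\<^bsub>G\<^esub> x)"

definition topological_group_iso ::
  "('a, 'm) monoid_scheme \<Rightarrow> 'a topology \<Rightarrow> ('b, 'n) monoid_scheme \<Rightarrow> 'b topology \<Rightarrow> ('a \<Rightarrow> 'b) \<Rightarrow> bool"
  where "topological_group_iso G T G' T' f \<longleftrightarrow> f \<in> iso G G' \<and> homeomorphic_map T T' f"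

text \<open>The limit of the system of groups \<open>X i\<close> (\<open>i \<in> I\<close>) with bonding maps \<open>p i j\<close> from \<open>X j\<close>
  to \<open>X i\<close> for \<open>i \<le> j\<close>, as a subgroup of the product. All groups \<open>X i\<close> are discrete.\<close>

definition inverse_limit ::
  "'i::order set \<Rightarrow> ('i \<Rightarrow> 'a monoid) \<Rightarrow> ('i \<Rightarrow> 'i \<Rightarrow> 'a \<Rightarrow> 'a) \<Rightarrow> ('i \<Rightarrow> 'a) monoid" where
  "inverse_limit I X p =
     (product_group I X)\<lparr>carrier :=
        {x \<in> carrier (product_group I X). \<forall>i\<in>I. \<forall>j\<in>I. i \<le> j \<longrightarrow> p i j (x j) = x i}\<rparr>"

definition inverse_limit_topology ::
  "'i::order set \<Rightarrow> ('i \<Rightarrow> 'a monoid) \<Rightarrow> ('i \<Rightarrow> 'i \<Rightarrow> 'a \<Rightarrow> 'a) \<Rightarrow> ('i \<Rightarrow> 'a) topology" where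
  "inverse_limit_topology I X p =
     subtopology (product_topology (\<lambda>i. discrete_topology (carrier (X i))) I)
       (carrier (inverse_limit I X p))"

definition semidirect_product ::
  "('a, 'm) monoid_scheme \<Rightarrow> ('b, 'n) monoid_scheme \<Rightarrow> ('b \<Rightarrow> 'a \<Rightarrow> 'a) \<Rightarrow> ('a \<times> 'b) monoid" where
  "semidirect_product A B \<alpha> =
     \<lparr>carrier = carrier A \<times> carrier B,
      monoid.mult = (\<lambda>(a, b) (a', b'). (a \<otimes>\<^bsub>A\<^esub> \<alpha> b a', b \<otimes>\<^bsub>B\<^esub> b')),
      one = (\<one>\<^bsub>A\<^esub>, \<one>\<^bsub>B\<^esub>)\<rparr>"

definition conjugate :: "('a, 'm) monoid_scheme \<Rightarrow> 'a \<Rightarrow> 'a set \<Rightarrow> 'a set" where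
  "conjugate G x A = (x <#\<^bsub>G\<^esub> A) #>\<^bsub>G\<^esub> (inv\<^bsub>G\<^esub> x)"


section \<open>Hecke pairs and Schlichting completions\<close>

definition hecke_pair :: "('a, 'm) monoid_scheme \<Rightarrow> 'a set \<Rightarrow> bool" where
  "hecke_pair G H \<longleftrightarrow> group G \<and> subgroup H G \<and>
     (\<forall>x\<in>carrier G. \<exists>Y. finite Y \<and> Y \<subseteq> carrier G \<and>
        H <#>\<^bsub>G\<^esub> (x <#\<^bsub>G\<^esub> H) = (\<Union>y\<in>Y. y <#\<^bsub>G\<^esub> H))"

definition reduced_hecke_pair :: "('a, 'm) monoid_scheme \<Rightarrow> 'a set \<Rightarrow> bool" where
  "reduced_hecke_pair G H \<longleftrightarrow>
     hecke_pair G H \<and> (\<Inter>x\<in>carrier G. conjugate G x H) = {\<one>\<^bsub>G\<^esub>}"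

text \<open>The lemmas below show that this is the group topology for which the conjugates of \<open>H\<close>
  form a local subbase of neighbourhoods of the identity.\<close>

definition hecke_topology :: "('a, 'm) monoid_scheme \<Rightarrow> 'a set \<Rightarrow> 'a topology" where
  "hecke_topology G H = topology (\<lambda>U. U \<subseteq> carrier G \<and>
     (\<forall>g\<in>U. \<exists>X. finite X \<and> X \<noteq> {} \<and> X \<subseteq> carrier G \<and>
        g <#\<^bsub>G\<^esub> (\<Inter>x\<in>X. conjugate G x H) \<subseteq> U))"

lemma openin_hecke_topology:
  "openin (hecke_topology G H) U \<longleftrightarrow> U \<subseteq> carrier G \<and>
     (\<forall>g\<in>U. \<exists>X. finite X \<and> X \<noteq> {} \<and> X \<subseteq> carrier G \<and>
        g <#\<^bsub>G\<^esub> (\<Inter>x\<in>X. conjugate G x H) \<subseteq> U)"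
proof -
  let ?P = "\<lambda>U. U \<subseteq> carrier G \<and>
     (\<forall>g\<in>U. \<exists>X. finite X \<and> X \<noteq> {} \<and> X \<subseteq> carrier G \<and>
        g <#\<^bsub>G\<^esub> (\<Inter>x\<in>X. conjugate G x H) \<subseteq> U)"
  have "istopology ?P"
    unfolding istopology_def
  proof (intro conjI allI impI)
    fix S T assume S: "?P S" and T: "?P T"
    then show "S \<inter> T \<subseteq> carrier G" by blast
    show "\<forall>g\<in>S \<inter> T. \<exists>X. finite X \<and> X \<noteq> {} \<and> X \<subseteq> carrier G \<and>
        g <#\<^bsub>G\<^esub> (\<Inter>x\<in>X. conjugate G x H) \<subseteq> S \<inter> T"
    proof
      fix g assume g: "g \<in> S \<inter> T"
      obtain X where X: "finite X" "X \<noteq> {}" "X \<subseteq> carrier G"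
          "g <#\<^bsub>G\<^esub> (\<Inter>x\<in>X. conjugate G x H) \<subseteq> S"
        using S g by blast
      obtain Y where Y: "finite Y" "Y \<subseteq> carrier G"
          "g <#\<^bsub>G\<^esub> (\<Inter>x\<in>Y. conjugate G x H) \<subseteq> T"
        using T g by blast
      have "g <#\<^bsub>G\<^esub> (\<Inter>x\<in>X \<union> Y. conjugate G x H) \<subseteq> S \<inter> T"
        using X(4) Y(3) by (fastforce simp: l_coset_def)
      with X Y show "\<exists>X. finite X \<and> X \<noteq> {} \<and> X \<subseteq> carrier G \<and>
          g <#\<^bsub>G\<^esub> (\<Inter>x\<in>X. conjugate G x H) \<subseteq> S \<inter> T"
        by (intro exI[of _ "X \<union> Y"]) auto
    qed
  next
    fix K assume K: "\<forall>S\<in>K. ?P S"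
    then show "\<Union>K \<subseteq> carrier G" by blast
    show "\<forall>g\<in>\<Union>K. \<exists>X. finite X \<and> X \<noteq> {} \<and> X \<subseteq> carrier G \<and>
        g <#\<^bsub>G\<^esub> (\<Inter>x\<in>X. conjugate G x H) \<subseteq> \<Union>K"
    proof
      fix g assume "g \<in> \<Union>K"
      then obtain S where "S \<in> K" "g \<in> S" by blast
      from K \<open>S \<in> K\<close> have "?P S" by (rule bspec)
      then have "\<exists>X. finite X \<and> X \<noteq> {} \<and> X \<subseteq> carrier G \<and>
          g <#\<^bsub>G\<^esub> (\<Inter>x\<in>X. conjugate G x H) \<subseteq> S"
        using \<open>g \<in> S\<close> by simp
      moreover have "S \<subseteq> \<Union>K" using \<open>S \<in> K\<close> by (rule Union_upper)
      ultimately show "\<exists>X. finite X \<and> X \<noteq> {} \<and> X \<subseteq> carrier G \<and>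
          g <#\<^bsub>G\<^esub> (\<Inter>x\<in>X. conjugate G x H) \<subseteq> \<Union>K"
        by (meson subset_trans)
    qed
  qed
  then show ?thesis
    unfolding hecke_topology_def by (simp add: topology_inverse')
qed

lemma (in group) mem_conjugate_iff:
  assumes "x \<in> carrier G" "H \<subseteq> carrier G"
  shows "a \<in> conjugate G x H \<longleftrightarrow> a \<in> carrier G \<and> inv x \<otimes> a \<otimes> x \<in> H"
proof
  assume "a \<in> conjugate G x H"
  then obtain h where h: "h \<in> H" "a = x \<otimes> h \<otimes> inv x"
    by (auto simp: conjugate_def l_coset_def r_coset_def)
  from h(1) have "h \<in> carrier G" using assms by blast
  moreover have "inv x \<otimes> (x \<otimes> h) = h"
    using \<open>h \<in> carrier G\<close> assms by (simp add: m_assoc[symmetric])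
  ultimately have "inv x \<otimes> a \<otimes> x = h"
    using h assms by (simp add: m_assoc)
  then show "a \<in> carrier G \<and> inv x \<otimes> a \<otimes> x \<in> H"
    using h assms \<open>h \<in> carrier G\<close> by simp
next
  assume a: "a \<in> carrier G \<and> inv x \<otimes> a \<otimes> x \<in> H"
  have "x \<otimes> (inv x \<otimes> a) = a"
    using a assms by (simp add: m_assoc[symmetric])
  then have "a = x \<otimes> (inv x \<otimes> a \<otimes> x) \<otimes> inv x"
    using a assms by (simp add: m_assoc)
  with a show "a \<in> conjugate G x H"
    by (force simp: conjugate_def l_coset_def r_coset_def)
qed

lemma (in group) subgroup_INT_conjugate:
  assumes H: "subgroup H G" and X: "X \<noteq> {}" "X \<subseteq> carrier G"
  shows "subgroup (\<Inter>x\<in>X. conjugate G x H) G"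
proof (rule subgroups_Inter)
  have HG: "H \<subseteq> carrier G" using H by (rule subgroup.subset)
  fix K assume "K \<in> (\<lambda>x. conjugate G x H) ` X"
  then obtain x where x: "x \<in> carrier G" "K = conjugate G x H" using X by blast
  show "subgroup K G"
  proof (rule subgroupI)
    show "K \<subseteq> carrier G" using x HG by (auto simp: mem_conjugate_iff)
    have "\<one> \<in> K"
      using x HG subgroup.one_closed[OF H] by (simp add: mem_conjugate_iff)
    then show "K \<noteq> {}" by blast
  next
    fix a assume "a \<in> K"
    then have a: "a \<in> carrier G" "inv x \<otimes> a \<otimes> x \<in> H"
      using x HG by (auto simp: mem_conjugate_iff)
    have "inv x \<otimes> inv a \<otimes> x = inv (inv x \<otimes> a \<otimes> x)"
      using a x by (simp add: inv_mult_group m_assoc)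
    then show "inv a \<in> K"
      using a x HG subgroup.m_inv_closed[OF H a(2)] by (simp add: mem_conjugate_iff)
  next
    fix a b assume "a \<in> K" "b \<in> K"
    then have a: "a \<in> carrier G" "inv x \<otimes> a \<otimes> x \<in> H"
      and b: "b \<in> carrier G" "inv x \<otimes> b \<otimes> x \<in> H"
      using x HG by (auto simp: mem_conjugate_iff)
    have "x \<otimes> (inv x \<otimes> (b \<otimes> x)) = b \<otimes> x"
      using b x by (simp add: m_assoc[symmetric])
    then have "inv x \<otimes> (a \<otimes> b) \<otimes> x = (inv x \<otimes> a \<otimes> x) \<otimes> (inv x \<otimes> b \<otimes> x)"
      using a b x by (simp add: m_assoc)
    then show "a \<otimes> b \<in> K"
      using a b x HG subgroup.m_closed[OF H a(2) b(2)] by (simp add: mem_conjugate_iff)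
  qed
qed (use X in auto)

lemma (in group) openin_hecke_coset:
  assumes H: "subgroup H G" and X: "finite X" "X \<noteq> {}" "X \<subseteq> carrier G" and g: "g \<in> carrier G"
  shows "openin (hecke_topology G H) (g <# (\<Inter>x\<in>X. conjugate G x H))"
    and "g \<in> g <# (\<Inter>x\<in>X. conjugate G x H)"
proof -
  let ?K = "\<Inter>x\<in>X. conjugate G x H"
  have K: "subgroup ?K G" using subgroup_INT_conjugate assms by blast
  have "g \<otimes> k <# ?K \<subseteq> g <# ?K" if k: "k \<in> ?K" for k
  proof
    fix z assume "z \<in> g \<otimes> k <# ?K"
    then obtain l where l: "l \<in> ?K" "z = g \<otimes> k \<otimes> l" unfolding l_coset_def by blast
    have "z = g \<otimes> (k \<otimes> l)"
      using l k g subgroup.mem_carrier[OF K] by (simp add: m_assoc del: INT_iff)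
    moreover have "k \<otimes> l \<in> ?K" using subgroup.m_closed[OF K k l(1)] .
    ultimately show "z \<in> g <# ?K" unfolding l_coset_def by blast
  qed
  then have "\<forall>z\<in>g <# ?K. z <# ?K \<subseteq> g <# ?K" unfolding l_coset_def by blast
  moreover have "g <# ?K \<subseteq> carrier G"
    using g subgroup.subset[OF K] by (rule l_coset_subset_G[rotated])
  ultimately show "openin (hecke_topology G H) (g <# ?K)"
    unfolding openin_hecke_topology using X by blast
  have "g = g \<otimes> \<one>" using g by simp
  then show "g \<in> g <# ?K"
    using subgroup.one_closed[OF K] unfolding l_coset_def by blast
qed

lemma (in group) topological_group_hecke_topology:
  assumes H: "subgroup H G"
  shows "topological_group G (hecke_topology G H)"
proof -
  let ?T = "hecke_topology G H"
  let ?K = "\<lambda>X. \<Inter>x\<in>X. conjugate G x H"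
  have HG: "H \<subseteq> carrier G" using H by (rule subgroup.subset)
  have open_carrier: "openin ?T (carrier G)"
  proof -
    have "g <# conjugate G \<one> H \<subseteq> carrier G" if "g \<in> carrier G" for g
      using that HG by (auto simp: l_coset_def mem_conjugate_iff)
    then show ?thesis unfolding openin_hecke_topology
      by (intro conjI ballI exI[of _ "{\<one>}"]) auto
  qed
  have top: "topspace ?T = carrier G"
  proof
    show "topspace ?T \<subseteq> carrier G"
      using openin_topspace[of ?T] unfolding openin_hecke_topology by (rule conjunct1)
  qed (rule openin_subset[OF open_carrier])
  have openD: "\<exists>X. finite X \<and> X \<noteq> {} \<and> X \<subseteq> carrier G \<and> g <# ?K X \<subseteq> U"
    if "openin ?T U" "g \<in> U" for U g
    using that(1)[unfolded openin_hecke_topology, THEN conjunct2] that(2) by (rule bspec)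
  have coset_mem: "g \<otimes> k \<in> g <# K" if "k \<in> K" for g k K
    using that by (auto simp: l_coset_def)
  have shift: "inv g \<otimes> k \<otimes> g \<in> ?K X"
    if "g \<in> carrier G" "X \<subseteq> carrier G" "X \<noteq> {}" "k \<in> ?K ((\<otimes>) g ` X)" for g k X
  proof -
    have "inv g \<otimes> k \<otimes> g \<in> conjugate G x H" if "x \<in> X" for x
    proof -
      have x: "x \<in> carrier G" using that \<open>X \<subseteq> carrier G\<close> by blast
      have "k \<in> conjugate G (g \<otimes> x) H" using \<open>k \<in> _\<close> that by blast
      then have "k \<in> carrier G" "inv (g \<otimes> x) \<otimes> k \<otimes> (g \<otimes> x) \<in> H"
        using \<open>g \<in> carrier G\<close> x HG by (auto simp: mem_conjugate_iff)
      then show ?thesis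
        using \<open>g \<in> carrier G\<close> x HG by (simp add: mem_conjugate_iff inv_mult_group m_assoc)
    qed
    then show ?thesis by blast
  qed
  have mult: "\<exists>V W. openin ?T V \<and> openin ?T W \<and> g \<in> V \<and> h \<in> W \<and> (\<forall>a\<in>V. \<forall>b\<in>W. a \<otimes> b \<in> U)"
    if U: "openin ?T U" and gh: "g \<in> carrier G" "h \<in> carrier G" "g \<otimes> h \<in> U" for U g h
  proof -
    obtain X where X: "finite X" "X \<noteq> {}" "X \<subseteq> carrier G" and sub: "g \<otimes> h <# ?K X \<subseteq> U"
      using openD[OF U gh(3)] by (elim exE conjE)
    have K: "subgroup (?K X) G" using subgroup_INT_conjugate H X by blast
    have X': "finite ((\<otimes>) h ` X)" "(\<otimes>) h ` X \<noteq> {}" "(\<otimes>) h ` X \<subseteq> carrier G"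
      using X gh by auto
    have K': "subgroup (?K ((\<otimes>) h ` X)) G" by (rule subgroup_INT_conjugate[OF H X'(2,3)])
    have "a \<otimes> b \<in> U" if ab: "a \<in> g <# ?K ((\<otimes>) h ` X)" "b \<in> h <# ?K X" for a b
    proof -
      obtain k l where k: "k \<in> ?K ((\<otimes>) h ` X)" "a = g \<otimes> k" and l: "l \<in> ?K X" "b = h \<otimes> l"
        using ab unfolding l_coset_def by blast
      have c: "k \<in> carrier G" "l \<in> carrier G"
        using subgroup.mem_carrier[OF K' k(1)] subgroup.mem_carrier[OF K l(1)] by auto
      have "h \<otimes> (inv h \<otimes> (k \<otimes> (h \<otimes> l))) = k \<otimes> (h \<otimes> l)"
        using c gh by (simp add: m_assoc[symmetric])
      then have "a \<otimes> b = g \<otimes> h \<otimes> ((inv h \<otimes> k \<otimes> h) \<otimes> l)"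
        using c gh k l by (simp add: m_assoc)
      moreover have "(inv h \<otimes> k \<otimes> h) \<otimes> l \<in> ?K X"
        using subgroup.m_closed[OF K shift[OF gh(2) X(3,2) k(1)] l(1)] .
      ultimately show ?thesis using coset_mem sub by (metis subsetD)
    qed
    then show ?thesis
      using openin_hecke_coset[OF H X gh(2)] openin_hecke_coset[OF H X' gh(1)]
      by (intro exI[of _ "g <# ?K ((\<otimes>) h ` X)"] exI[of _ "h <# ?K X"]) (simp del: INT_iff)
  qed
  have "continuous_map (prod_topology ?T ?T) ?T (\<lambda>(x, y). x \<otimes> y)"
    unfolding continuous_map_def
  proof (intro conjI allI impI)
    show "(\<lambda>(x, y). x \<otimes> y) \<in> topspace (prod_topology ?T ?T) \<rightarrow> topspace ?T"
      by (auto simp: top)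
  next
    fix U assume U: "openin ?T U"
    show "openin (prod_topology ?T ?T)
        {z \<in> topspace (prod_topology ?T ?T). (case z of (x, y) \<Rightarrow> x \<otimes> y) \<in> U}"
      unfolding openin_prod_topology_alt
    proof (intro allI impI)
      fix g h
      assume "(g, h) \<in> {z \<in> topspace (prod_topology ?T ?T). (case z of (x, y) \<Rightarrow> x \<otimes> y) \<in> U}"
      then obtain V W where VW: "openin ?T V" "openin ?T W" "g \<in> V" "h \<in> W"
          "\<forall>a\<in>V. \<forall>b\<in>W. a \<otimes> b \<in> U"
        using mult[OF U, of g h] by (auto simp: top)
      then show "\<exists>V W. openin ?T V \<and> openin ?T W \<and> g \<in> V \<and> h \<in> W \<and>
          V \<times> W \<subseteq> {z \<in> topspace (prod_topology ?T ?T). (case z of (x, y) \<Rightarrow> x \<otimes> y) \<in> U}"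
        using openin_subset[OF VW(1)] openin_subset[OF VW(2)]
        by (intro exI[of _ V] exI[of _ W]) auto
    qed
  qed
  moreover have "continuous_map ?T ?T (\<lambda>x. inv x)"
    unfolding continuous_map_def
  proof (intro conjI allI impI)
    show "(\<lambda>x. inv x) \<in> topspace ?T \<rightarrow> topspace ?T" by (auto simp: top)
  next
    fix U assume U: "openin ?T U"
    show "openin ?T {x \<in> topspace ?T. inv x \<in> U}"
      unfolding openin_hecke_topology
    proof (intro conjI ballI)
      show "{x \<in> topspace ?T. inv x \<in> U} \<subseteq> carrier G" by (auto simp: top)
    next
      fix g assume "g \<in> {x \<in> topspace ?T. inv x \<in> U}"
      then have g: "g \<in> carrier G" "inv g \<in> U" by (auto simp: top)
      obtain X where X: "finite X" "X \<noteq> {}" "X \<subseteq> carrier G" and sub: "inv g <# ?K X \<subseteq> U"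
        using openD[OF U g(2)] by (elim exE conjE)
      have K: "subgroup (?K X) G" using subgroup_INT_conjugate H X by blast
      have ig: "inv g \<in> carrier G" using g by simp
      have X': "finite ((\<otimes>) (inv g) ` X)" "(\<otimes>) (inv g) ` X \<noteq> {}"
          "(\<otimes>) (inv g) ` X \<subseteq> carrier G"
        using X g by auto
      have K': "subgroup (?K ((\<otimes>) (inv g) ` X)) G" by (rule subgroup_INT_conjugate[OF H X'(2,3)])
      have "g <# ?K ((\<otimes>) (inv g) ` X) \<subseteq> {x \<in> topspace ?T. inv x \<in> U}"
      proof
        fix a assume "a \<in> g <# ?K ((\<otimes>) (inv g) ` X)"
        then obtain k where k: "k \<in> ?K ((\<otimes>) (inv g) ` X)" "a = g \<otimes> k"
          unfolding l_coset_def by blast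
        have c: "k \<in> carrier G" using subgroup.mem_carrier[OF K' k(1)] .
        have ik: "inv k \<in> ?K ((\<otimes>) (inv g) ` X)" using subgroup.m_inv_closed[OF K' k(1)] .
        have "inv g \<otimes> (g \<otimes> (inv k \<otimes> inv g)) = inv k \<otimes> inv g"
          using c g by (simp add: m_assoc[symmetric])
        then have "inv a = inv g \<otimes> (inv (inv g) \<otimes> inv k \<otimes> inv g)"
          using c g k by (simp add: inv_mult_group m_assoc)
        then have "inv a \<in> U"
          using sub coset_mem[OF shift[OF ig X(3,2) ik], of "inv g"] by (simp only: subsetD)
        then show "a \<in> {x \<in> topspace ?T. inv x \<in> U}" using c g k by (simp add: top)
      qed
      with X' show "\<exists>X. finite X \<and> X \<noteq> {} \<and> X \<subseteq> carrier G \<and>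
          g <# ?K X \<subseteq> {x \<in> topspace ?T. inv x \<in> U}"
        by (intro exI[of _ "(\<otimes>) (inv g) ` X"] conjI)
    qed
  qed
  ultimately show ?thesis
    unfolding topological_group_def using top is_group by blast
qed

lemma (in group) hecke_topology_local_subbase:
  assumes H: "subgroup H G"
  shows "x \<in> carrier G \<Longrightarrow>
           openin (hecke_topology G H) (conjugate G x H) \<and> \<one> \<in> conjugate G x H"
    and "openin (hecke_topology G H) U \<Longrightarrow> \<one> \<in> U \<Longrightarrow>
           \<exists>X. finite X \<and> X \<noteq> {} \<and> X \<subseteq> carrier G \<and> (\<Inter>x\<in>X. conjugate G x H) \<subseteq> U"
proof -
  have one: "\<one> <# (\<Inter>x\<in>X. conjugate G x H) = (\<Inter>x\<in>X. conjugate G x H)"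
    if "X \<noteq> {}" "X \<subseteq> carrier G" for X
    by (rule lcos_mult_one[OF subgroup.subset[OF subgroup_INT_conjugate[OF H that]]])
  show "openin (hecke_topology G H) (conjugate G x H) \<and> \<one> \<in> conjugate G x H"
    if "x \<in> carrier G"
    using openin_hecke_coset[OF H, of "{x}" \<one>] one[of "{x}"] that by simp
  show "\<exists>X. finite X \<and> X \<noteq> {} \<and> X \<subseteq> carrier G \<and> (\<Inter>x\<in>X. conjugate G x H) \<subseteq> U"
    if "openin (hecke_topology G H) U" "\<one> \<in> U"
    using that one unfolding openin_hecke_topology by metis
qed

text \<open>The join of the left and the right uniformity, as a filter of entourages.\<close>

definition two_sided_uniformity :: "('a, 'm) monoid_scheme \<Rightarrow> 'a topology \<Rightarrow> ('a \<times> 'a) filter" where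
  "two_sided_uniformity G T = (INF U\<in>{U. openin T U \<and> \<one>\<^bsub>G\<^esub> \<in> U}.
     principal {(x, y). x \<in> carrier G \<and> y \<in> carrier G \<and>
                        inv\<^bsub>G\<^esub> x \<otimes>\<^bsub>G\<^esub> y \<in> U \<and> x \<otimes>\<^bsub>G\<^esub> inv\<^bsub>G\<^esub> y \<in> U})"

definition two_sided_complete :: "('a, 'm) monoid_scheme \<Rightarrow> 'a topology \<Rightarrow> bool" where
  "two_sided_complete G T \<longleftrightarrow>
     (\<forall>F. F \<le> principal (carrier G) \<longrightarrow> F \<noteq> bot \<longrightarrow> F \<times>\<^sub>F F \<le> two_sided_uniformity G T \<longrightarrow>
        (\<exists>x\<in>carrier G. F \<le> nhdsin T x))"

text \<open>The (Hausdorff) completion of \<open>(G, T)\<close> in its two-sided uniformity is determined only up to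
  unique isomorphism; it is a complete Hausdorff group \<open>(Gb, Tb)\<close> with a homomorphism \<open>\<iota>\<close> from \<open>G\<close>
  that has dense image and induces the uniformity of \<open>G\<close>.\<close>

definition two_sided_completion ::
  "('a, 'm) monoid_scheme \<Rightarrow> 'a topology \<Rightarrow> ('b, 'n) monoid_scheme \<Rightarrow> 'b topology \<Rightarrow> ('a \<Rightarrow> 'b) \<Rightarrow> bool"
  where
  "two_sided_completion G T Gb Tb \<iota> \<longleftrightarrow>
     topological_group Gb Tb \<and> Hausdorff_space Tb \<and> two_sided_complete Gb Tb \<and>
     \<iota> \<in> hom G Gb \<and>
     Tb closure_of (\<iota> ` carrier G) = carrier Gb \<and>
     two_sided_uniformity G T =
       inf (filtercomap (map_prod \<iota> \<iota>) (two_sided_uniformity Gb Tb))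
           (principal (carrier G \<times> carrier G))"

definition schlichting_completion ::
  "('a, 'm) monoid_scheme \<Rightarrow> 'a set \<Rightarrow>
   ('b, 'n) monoid_scheme \<Rightarrow> 'b set \<Rightarrow> 'b topology \<Rightarrow> ('a \<Rightarrow> 'b) \<Rightarrow> bool" where
  "schlichting_completion G H Gb Hb Tb \<iota> \<longleftrightarrow>
     two_sided_completion G (hecke_topology G H) Gb Tb \<iota> \<and> Hb = Tb closure_of (\<iota> ` H)"


section \<open>The families of normal subgroups\<close>

text \<open>Empty intersections, which are \<open>UNIV\<close>, do not occur: \<open>E\<close> contains the identity for
  every \<open>E\<close> in \<open>E_family\<close>, and hence \<open>F\<close> contains \<open>M\<close> for every \<open>(E, F)\<close> in \<open>EF_family\<close>.\<close>

definition M_sub :: "('a, 'm) monoid_scheme \<Rightarrow> 'a set \<Rightarrow> 'a set \<Rightarrow> 'a set" where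
  "M_sub G M E = (\<Inter>q\<in>E. M \<inter> conjugate G q M)"

definition R_stab :: "('a, 'm) monoid_scheme \<Rightarrow> 'a set \<Rightarrow> 'a set \<Rightarrow> 'a \<Rightarrow> 'a set" where
  "R_stab G M R n = {r \<in> R. conjugate G r (n <#\<^bsub>G\<^esub> M) = n <#\<^bsub>G\<^esub> M}"

definition R_sub :: "('a, 'm) monoid_scheme \<Rightarrow> 'a set \<Rightarrow> 'a set \<Rightarrow> 'a set \<times> 'a set \<Rightarrow> 'a set" where
  "R_sub G M R = (\<lambda>(E, F). (\<Inter>q\<in>E. conjugate G q (\<Inter>n\<in>F. R_stab G M R n)) \<inter> R)"

definition E_family :: "('a, 'm) monoid_scheme \<Rightarrow> 'a set \<Rightarrow> 'a set \<Rightarrow> 'a set set" where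
  "E_family G Q R = {E. E \<subseteq> Q \<and>
     (\<exists>X. finite X \<and> X \<subseteq> Q \<and> E = (\<Union>x\<in>X. x <#\<^bsub>G\<^esub> R)) \<and>
     \<one>\<^bsub>G\<^esub> \<in> E \<and> R <#>\<^bsub>G\<^esub> E = E}"

definition EF_family ::
  "('a, 'm) monoid_scheme \<Rightarrow> 'a set \<Rightarrow> 'a set \<Rightarrow> 'a set \<Rightarrow> 'a set \<Rightarrow> ('a set \<times> 'a set) set" where
  "EF_family G N Q M R = {(E, F). E \<in> E_family G Q R \<and> F \<subseteq> N \<and>
     (\<exists>X. finite X \<and> X \<subseteq> N \<and> F = (\<Union>x\<in>X. x <#\<^bsub>G\<^esub> M)) \<and>
     (\<forall>q\<in>E. conjugate G (inv\<^bsub>G\<^esub> q) M \<subseteq> F)}"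


section \<open>The four inverse systems\<close>

text \<open>For normal subgroups \<open>K' \<subseteq> K\<close> the canonical map from cosets of \<open>K'\<close> to cosets of \<open>K\<close> sends
  \<open>C\<close> to \<open>K <#> C\<close>. The order on the pairs \<open>(E, F)\<close> is componentwise inclusion.\<close>

definition proj_E :: "('a, 'm) monoid_scheme \<Rightarrow> 'a set \<Rightarrow> 'a set \<Rightarrow> 'a set \<Rightarrow> 'a set \<Rightarrow> 'a set" where
  "proj_E G M = (\<lambda>E E' C. M_sub G M E <#>\<^bsub>G\<^esub> C)"

definition proj_R ::
  "('a, 'm) monoid_scheme \<Rightarrow> 'a set \<Rightarrow> 'a set \<Rightarrow>
   'a set \<times> 'a set \<Rightarrow> 'a set \<times> 'a set \<Rightarrow> 'a set \<Rightarrow> 'a set" where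
  "proj_R G M R = (\<lambda>i j C. R_sub G M R i <#>\<^bsub>G\<^esub> C)"

definition proj_H ::
  "('a, 'm) monoid_scheme \<Rightarrow> 'a set \<Rightarrow> 'a set \<Rightarrow>
   'a set \<times> 'a set \<Rightarrow> 'a set \<times> 'a set \<Rightarrow> 'a set \<times> 'a set \<Rightarrow> 'a set \<times> 'a set" where
  "proj_H G M R = (\<lambda>i j. map_prod (proj_E G M (fst i) (fst j)) (proj_R G M R i j))"

text \<open>The action of \<open>R/R\<^sup>E\<^sub>F\<close> on \<open>M/M\<^sub>E\<close> induced by conjugation:
  for \<open>(E, F)\<close> in \<open>EF_family\<close> the coset of \<open>r\<close> sends the coset of \<open>m\<close> to that of \<open>r m r\<^sup>-\<^sup>1\<close>.\<close>

definition coset_conj :: "('a, 'm) monoid_scheme \<Rightarrow> 'a set \<Rightarrow> 'a set \<Rightarrow> 'a set" where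
  "coset_conj G C D = (\<Union>r\<in>C. \<Union>m\<in>D. {r \<otimes>\<^bsub>G\<^esub> m \<otimes>\<^bsub>G\<^esub> inv\<^bsub>G\<^esub> r})"

definition quot_H ::
  "('a, 'm) monoid_scheme \<Rightarrow> 'a set \<Rightarrow> 'a set \<Rightarrow> 'a set \<times> 'a set \<Rightarrow> ('a set \<times> 'a set) monoid" where
  "quot_H G M R i =
     semidirect_product (G\<lparr>carrier := M\<rparr> Mod M_sub G M (fst i)) (G\<lparr>carrier := R\<rparr> Mod R_sub G M R i)
       (coset_conj G)"

end

theory Submission
  imports Defs
begin

text \<open>Let \<open>A\<close> be a subgroup of \<open>G\<close> and \<open>K i\<close> a directed family of normal subgroups of \<open>A\<close> that is a
  neighbourhood base of the identity in \<open>A\<close>. Then the fibres of \<open>A \<rightarrow> A/K i\<close> have disjoint closures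
  that are open in the closure of \<open>A\<close>, so the projections extend continuously to the closure of \<open>A\<close>;
  together they give a topological isomorphism onto \<open>lim A/K i\<close>, where surjectivity is completeness:
  the fibres over a compatible family generate a Cauchy filter.

  Conjugation by \<open>x\<close> sees only the coset \<open>x H\<close>, and by the Hecke condition \<open>H S\<close> meets finitely many
  left cosets of \<open>H\<close> whenever \<open>S\<close> does. Hence \<open>M\<^sub>E\<close> is \<open>N\<close> intersected with finitely many
  \<open>q H q\<^sup>-\<^sup>1\<close>, and \<open>R\<^sup>E\<^sub>F\<close> is \<open>R\<close> intersected with the \<open>x H x\<^sup>-\<^sup>1\<close> for \<open>x \<in> E F\<close>, again finitely many; and
  since every element of \<open>G = Q N\<close> lies in such a set \<open>E F\<close>, these subgroups are neighbourhood bases.\<close>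

section \<open>Topological groups and their completions\<close>

text \<open>The completion is known only by its characterization, so nothing is computed inside
  \<open>Gb\<close>: the equality of uniformities is used solely to carry neighbourhoods of the
  identity along \<open>\<iota>\<close> in both directions. That \<open>M_sub\<close> depends on
  \<open>E\<close> alone while \<open>R_sub\<close> depends on a pair comes from writing conjugators
  as \<open>x = q \<otimes> n\<close>, with the \<open>Q\<close>-part acting first. Once
  \<open>a\<close> has been moved into \<open>M\<close> by \<open>q\<close>, the factor
  \<open>n\<close> cannot move it out, because \<open>M\<close> is normal in \<open>N\<close>. An
  element of \<open>R\<close> has no such protection: conjugation by \<open>n\<close> takes it out
  of \<open>Q\<close>, so the \<open>n\<close> in \<open>F\<close> must be recorded as well. For
  this reason conditions on \<open>R\<close> are always phrased as membership in \<open>H\<close>,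
  which is decided through the unique decomposition \<open>N Q\<close>. The terms of the fourth
  system are semidirect products and not literally quotients of \<open>H\<close>; therefore the
  limit argument is made for arbitrary groups with compatible surjections, and quotients are only a
  special case.\<close>

lemma (in group) inv_mult_cancel:
  assumes "x \<in> carrier G" "y \<in> carrier G"
  shows "inv x \<otimes> (x \<otimes> y) = y" and "x \<otimes> (inv x \<otimes> y) = y"
  using assms by (simp_all flip: m_assoc)

lemma closure_of_meets_open:
  assumes "x \<in> X closure_of S" "openin X V" "x \<in> V"
  obtains y where "y \<in> S" "y \<in> V"
  using assms by (auto simp: in_closure_of)

section \<open>Closures and small neighbourhoods in topological groups\<close>

lemma topological_group_closure_of_mult:
  assumes "topological_group G T" and x: "x \<in> T closure_of S" and y: "y \<in> T closure_of S'"
    and Z: "\<And>s s'. s \<in> S \<Longrightarrow> s' \<in> S' \<Longrightarrow> s \<otimes>\<^bsub>G\<^esub> s' \<in> Z"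
  shows "x \<otimes>\<^bsub>G\<^esub> y \<in> T closure_of Z"
proof -
  let ?m = "\<lambda>(x, y). x \<otimes>\<^bsub>G\<^esub> y"
  have "continuous_map (prod_topology T T) T ?m"
    using assms(1) by (simp add: topological_group_def)
  then have "?m ` (prod_topology T T closure_of (S \<times> S')) \<subseteq> T closure_of (?m ` (S \<times> S'))"
    by (rule continuous_map_image_closure_subset)
  moreover have "?m ` (S \<times> S') \<subseteq> Z" using Z by auto
  ultimately show ?thesis
    using x y closure_of_mono[of "?m ` (S \<times> S')" Z T] by (force simp: closure_of_Times)
qed

lemma topological_group_closure_of_inv:
  assumes "topological_group G T" and x: "x \<in> T closure_of S"
  shows "inv\<^bsub>G\<^esub> x \<in> T closure_of ((\<lambda>s. inv\<^bsub>G\<^esub> s) ` S)"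
proof -
  have "continuous_map T T (\<lambda>s. inv\<^bsub>G\<^esub> s)"
    using assms(1) by (simp add: topological_group_def)
  from continuous_map_image_closure_subset[OF this, of S] x show ?thesis by blast
qed

lemma topological_group_openin_translate:
  assumes T: "topological_group G T" and V: "openin T V" and g: "g \<in> carrier G"
  shows "openin T {y \<in> carrier G. g \<otimes>\<^bsub>G\<^esub> y \<in> V}" and "openin T {y \<in> carrier G. y \<otimes>\<^bsub>G\<^esub> g \<in> V}"
proof -
  have top: "topspace T = carrier G"
    and m: "continuous_map (prod_topology T T) T (\<lambda>(x, y). x \<otimes>\<^bsub>G\<^esub> y)"
    using T by (auto simp: topological_group_def)
  have "continuous_map T (prod_topology T T) (\<lambda>y. (g, y))"
    "continuous_map T (prod_topology T T) (\<lambda>y. (y, g))"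
    using g by (auto simp: continuous_map_pairedI top)
  from this[THEN continuous_map_compose, OF m]
  have "continuous_map T T (\<lambda>y. g \<otimes>\<^bsub>G\<^esub> y)" "continuous_map T T (\<lambda>y. y \<otimes>\<^bsub>G\<^esub> g)"
    by (simp_all add: o_def)
  from this[THEN openin_continuous_map_preimage, OF V]
  show "openin T {y \<in> carrier G. g \<otimes>\<^bsub>G\<^esub> y \<in> V}" "openin T {y \<in> carrier G. y \<otimes>\<^bsub>G\<^esub> g \<in> V}"
    by (simp_all add: top)
qed

text \<open>Continuity of \<open>inv a \<otimes> b\<close> at the pair of identities. Putting
  \<open>\<one>\<close> for \<open>a\<close> or for \<open>b\<close> shows that \<open>W\<close> and
  its inverses lie in \<open>V\<close>, which is how both halves of a two-sided entourage are
  checked later.\<close>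

lemma topological_group_symmetric_nhd:
  fixes G :: "('a, 'm) monoid_scheme" (structure)
  assumes T: "topological_group G T" and V: "openin T V" "\<one>\<^bsub>G\<^esub> \<in> V"
  obtains W where "openin T W" "\<one>\<^bsub>G\<^esub> \<in> W" "\<And>a b. a \<in> W \<Longrightarrow> b \<in> W \<Longrightarrow> inv\<^bsub>G\<^esub> a \<otimes>\<^bsub>G\<^esub> b \<in> V"
proof -
  interpret group G using T by (simp add: topological_group_def)
  have top: "topspace T = carrier G"
    and m: "continuous_map (prod_topology T T) T (\<lambda>(x, y). x \<otimes> y)"
    and i: "continuous_map T T (\<lambda>x. inv x)"
    using T by (auto simp: topological_group_def)
  have "continuous_map (prod_topology T T) (prod_topology T T) (\<lambda>z. (inv (fst z), snd z))"
    using i by (auto intro!: continuous_map_pairedI continuous_map_snd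
        continuous_map_compose[OF continuous_map_fst, unfolded o_def])
  from continuous_map_compose[OF this m]
  have "continuous_map (prod_topology T T) T (\<lambda>z. inv (fst z) \<otimes> snd z)"
    by (simp add: o_def)
  from openin_continuous_map_preimage[OF this V(1)]
  have "openin (prod_topology T T) {z \<in> carrier G \<times> carrier G. inv (fst z) \<otimes> snd z \<in> V}"
    by (simp add: top)
  moreover have "(\<one>, \<one>) \<in> {z \<in> carrier G \<times> carrier G. inv (fst z) \<otimes> snd z \<in> V}"
    using V by simp
  ultimately obtain A B where "openin T A" "openin T B" "\<one> \<in> A" "\<one> \<in> B"
    "A \<times> B \<subseteq> {z \<in> carrier G \<times> carrier G. inv (fst z) \<otimes> snd z \<in> V}"
    unfolding openin_prod_topology_alt by meson
  then show ?thesis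
    by (intro that[of "A \<inter> B"]) auto
qed

text \<open>If \<open>y\<close> lies in the closure of \<open>W\<close>, then the neighbourhood
  \<open>W y\<close> of \<open>y\<close> meets \<open>W\<close> in some \<open>z\<close>, and
  \<open>y = (z y^-1)^-1 z\<close> lies in \<open>W^-1 W\<close>.\<close>

lemma topological_group_regular:
  fixes G :: "('a, 'm) monoid_scheme" (structure)
  assumes T: "topological_group G T" and V: "openin T V" "\<one>\<^bsub>G\<^esub> \<in> V"
  obtains W where "openin T W" "\<one>\<^bsub>G\<^esub> \<in> W" "T closure_of W \<subseteq> V"
proof -
  interpret group G using T by (simp add: topological_group_def)
  have top: "topspace T = carrier G" using T by (simp add: topological_group_def)
  obtain W where W: "openin T W" "\<one> \<in> W" "\<And>a b. a \<in> W \<Longrightarrow> b \<in> W \<Longrightarrow> inv a \<otimes> b \<in> V"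
    using topological_group_symmetric_nhd[OF assms] by blast
  have "y \<in> V" if y: "y \<in> T closure_of W" for y
  proof -
    have yc: "y \<in> carrier G" using y by (simp add: in_closure_of top)
    have "openin T {z \<in> carrier G. z \<otimes> inv y \<in> W}"
      by (rule topological_group_openin_translate(2)[OF T W(1)]) (use yc in simp)
    moreover have "y \<in> {z \<in> carrier G. z \<otimes> inv y \<in> W}" using yc W by simp
    ultimately obtain z where "z \<in> W" "z \<in> {z \<in> carrier G. z \<otimes> inv y \<in> W}"
      using closure_of_meets_open[OF y] by blast
    then have z: "z \<in> carrier G" "z \<otimes> inv y \<in> W" "z \<in> W" by auto
    have "inv (z \<otimes> inv y) \<otimes> z = y" using z yc by (simp add: inv_mult_group m_assoc)
    then show ?thesis using W(3)[OF z(2,3)] by simp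
  qed
  then show ?thesis using W that by blast
qed

text \<open>The entourage of \<open>a \<inter> b\<close> lies in those of \<open>a\<close> and
  \<open>b\<close>, so the infimum runs over a filter base and a single neighbourhood
  suffices.\<close>

lemma eventually_two_sided_uniformity:
  fixes G :: "('a, 'm) monoid_scheme" (structure)
  assumes T: "topological_group G T"
  shows "eventually P (two_sided_uniformity G T) \<longleftrightarrow>
    (\<exists>U. openin T U \<and> \<one>\<^bsub>G\<^esub> \<in> U \<and> (\<forall>x\<in>carrier G. \<forall>y\<in>carrier G.
       inv\<^bsub>G\<^esub> x \<otimes>\<^bsub>G\<^esub> y \<in> U \<longrightarrow> x \<otimes>\<^bsub>G\<^esub> inv\<^bsub>G\<^esub> y \<in> U \<longrightarrow> P (x, y)))"
proof -
  interpret group G using T by (simp add: topological_group_def)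
  let ?U = "{U. openin T U \<and> \<one> \<in> U}"
  let ?E = "\<lambda>U. {(x, y). x \<in> carrier G \<and> y \<in> carrier G \<and> inv x \<otimes> y \<in> U \<and> x \<otimes> inv y \<in> U}"
  have "carrier G \<in> ?U"
    using T openin_topspace[of T] by (simp add: topological_group_def)
  then have ne: "?U \<noteq> {}" by blast
  have dir: "\<exists>x\<in>?U. principal (?E x) \<le> inf (principal (?E a)) (principal (?E b))"
    if "a \<in> ?U" "b \<in> ?U" for a b
    using that by (intro bexI[of _ "a \<inter> b"]) auto
  have "Ball (?E U) P \<longleftrightarrow> (\<forall>x\<in>carrier G. \<forall>y\<in>carrier G.
      inv x \<otimes> y \<in> U \<longrightarrow> x \<otimes> inv y \<in> U \<longrightarrow> P (x, y))" for U
    by auto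
  moreover have "eventually P (INF U\<in>?U. principal (?E U)) \<longleftrightarrow>
      (\<exists>U\<in>?U. eventually P (principal (?E U)))"
    by (rule eventually_INF_base[OF ne dir])
  ultimately show ?thesis
    unfolding two_sided_uniformity_def eventually_principal by simp
qed

section \<open>Transfer of neighbourhoods along the completion map\<close>

locale two_sided_completed_group =
  fixes G :: "('a, 'm) monoid_scheme" (structure) and T
    and Gb :: "('b, 'n) monoid_scheme" and Tb \<iota>
  assumes T: "topological_group G T" and completion: "two_sided_completion G T Gb Tb \<iota>"
begin

sublocale group G
  using T by (simp add: topological_group_def)

lemma Tb: "topological_group Gb Tb"
  using completion by (simp add: two_sided_completion_def)

sublocale Gb: group Gb
  using Tb by (simp add: topological_group_def)

lemma topspace_Tb [simp]: "topspace Tb = carrier Gb"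
  using Tb by (simp add: topological_group_def)

sublocale group_hom G Gb \<iota>
  using completion by unfold_locales (simp add: two_sided_completion_def)

lemma eventually_uniformity_iff:
  "eventually P (two_sided_uniformity G T) \<longleftrightarrow>
    (\<exists>V. openin Tb V \<and> \<one>\<^bsub>Gb\<^esub> \<in> V \<and> (\<forall>x\<in>carrier G. \<forall>y\<in>carrier G.
       inv\<^bsub>Gb\<^esub> \<iota> x \<otimes>\<^bsub>Gb\<^esub> \<iota> y \<in> V \<longrightarrow> \<iota> x \<otimes>\<^bsub>Gb\<^esub> inv\<^bsub>Gb\<^esub> \<iota> y \<in> V \<longrightarrow> P (x, y)))"
    (is "_ \<longleftrightarrow> ?R")
proof -
  have "two_sided_uniformity G T = inf (filtercomap (map_prod \<iota> \<iota>) (two_sided_uniformity Gb Tb))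
           (principal (carrier G \<times> carrier G))"
    using completion by (simp add: two_sided_completion_def)
  then have "eventually P (two_sided_uniformity G T) \<longleftrightarrow>
    (\<exists>Q. eventually Q (two_sided_uniformity Gb Tb) \<and>
       (\<forall>x\<in>carrier G. \<forall>y\<in>carrier G. Q (\<iota> x, \<iota> y) \<longrightarrow> P (x, y)))"
    by (auto simp: eventually_inf_principal eventually_filtercomap)
  also have "\<dots> \<longleftrightarrow> ?R"
  proof
    assume ?R
    then obtain V where V: "openin Tb V" "\<one>\<^bsub>Gb\<^esub> \<in> V"
      "\<forall>x\<in>carrier G. \<forall>y\<in>carrier G. inv\<^bsub>Gb\<^esub> \<iota> x \<otimes>\<^bsub>Gb\<^esub> \<iota> y \<in> V \<longrightarrow>
         \<iota> x \<otimes>\<^bsub>Gb\<^esub> inv\<^bsub>Gb\<^esub> \<iota> y \<in> V \<longrightarrow> P (x, y)" by blast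
    then show "\<exists>Q. eventually Q (two_sided_uniformity Gb Tb) \<and>
       (\<forall>x\<in>carrier G. \<forall>y\<in>carrier G. Q (\<iota> x, \<iota> y) \<longrightarrow> P (x, y))"
      unfolding eventually_two_sided_uniformity[OF Tb]
      by (intro exI[of _ "\<lambda>(x, y). inv\<^bsub>Gb\<^esub> x \<otimes>\<^bsub>Gb\<^esub> y \<in> V \<and> x \<otimes>\<^bsub>Gb\<^esub> inv\<^bsub>Gb\<^esub> y \<in> V"]) auto
  next
    assume "\<exists>Q. eventually Q (two_sided_uniformity Gb Tb) \<and>
       (\<forall>x\<in>carrier G. \<forall>y\<in>carrier G. Q (\<iota> x, \<iota> y) \<longrightarrow> P (x, y))"
    then show ?R
      unfolding eventually_two_sided_uniformity[OF Tb] by (meson hom_closed)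
  qed
  finally show ?thesis .
qed

text \<open>Compare the entourage of \<open>U\<close> at the pair \<open>(\<one>, x)\<close>. Such a
  comparison tests \<open>\<iota> x\<close> and its inverse at once, hence the shrinking of
  \<open>V\<close> to \<open>W\<close>. Together with \<open>nhd_pullback\<close> it says that
  \<open>G\<close> carries the topology induced by \<open>\<iota>\<close> at the identity.\<close>

lemma nhd_pushforward:
  assumes U: "openin T U" "\<one> \<in> U"
  obtains V where "openin Tb V" "\<one>\<^bsub>Gb\<^esub> \<in> V" "\<And>x. x \<in> carrier G \<Longrightarrow> \<iota> x \<in> V \<Longrightarrow> x \<in> U"
proof -
  have "eventually (\<lambda>(x, y). inv x \<otimes> y \<in> U) (two_sided_uniformity G T)"
    unfolding eventually_two_sided_uniformity[OF T] using U by auto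
  then obtain V where V: "openin Tb V" "\<one>\<^bsub>Gb\<^esub> \<in> V"
    "\<And>x y. x \<in> carrier G \<Longrightarrow> y \<in> carrier G \<Longrightarrow> inv\<^bsub>Gb\<^esub> \<iota> x \<otimes>\<^bsub>Gb\<^esub> \<iota> y \<in> V \<Longrightarrow>
       \<iota> x \<otimes>\<^bsub>Gb\<^esub> inv\<^bsub>Gb\<^esub> \<iota> y \<in> V \<Longrightarrow> inv x \<otimes> y \<in> U"
    unfolding eventually_uniformity_iff by auto
  obtain W where W: "openin Tb W" "\<one>\<^bsub>Gb\<^esub> \<in> W"
    "\<And>a b. a \<in> W \<Longrightarrow> b \<in> W \<Longrightarrow> inv\<^bsub>Gb\<^esub> a \<otimes>\<^bsub>Gb\<^esub> b \<in> V"
    using topological_group_symmetric_nhd[OF Tb V(1,2)] by blast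
  show ?thesis
  proof (rule that[OF W(1,2)])
    fix x assume x: "x \<in> carrier G" "\<iota> x \<in> W"
    show "x \<in> U"
      using V(3)[of \<one> x] W(3)[OF W(2) x(2)] W(3)[OF x(2) W(2)] x by simp
  qed
qed

lemma nhd_pullback:
  assumes V: "openin Tb V" "\<one>\<^bsub>Gb\<^esub> \<in> V"
  obtains U where "openin T U" "\<one> \<in> U" "\<And>x. x \<in> U \<Longrightarrow> \<iota> x \<in> V"
proof -
  have "eventually (\<lambda>(x, y). inv\<^bsub>Gb\<^esub> \<iota> x \<otimes>\<^bsub>Gb\<^esub> \<iota> y \<in> V) (two_sided_uniformity G T)"
    unfolding eventually_uniformity_iff using V by auto
  then obtain U where U: "openin T U" "\<one> \<in> U"
    "\<And>x y. x \<in> carrier G \<Longrightarrow> y \<in> carrier G \<Longrightarrow> inv x \<otimes> y \<in> U \<Longrightarrow>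
       x \<otimes> inv y \<in> U \<Longrightarrow> inv\<^bsub>Gb\<^esub> \<iota> x \<otimes>\<^bsub>Gb\<^esub> \<iota> y \<in> V"
    unfolding eventually_two_sided_uniformity[OF T] by auto
  obtain W where W: "openin T W" "\<one> \<in> W"
    "\<And>a b. a \<in> W \<Longrightarrow> b \<in> W \<Longrightarrow> inv a \<otimes> b \<in> U"
    using topological_group_symmetric_nhd[OF T U(1,2)] by blast
  show ?thesis
  proof (rule that[OF W(1,2)])
    fix x assume x: "x \<in> W"
    have "x \<in> carrier G"
      using x openin_subset[OF W(1)] T by (auto simp: topological_group_def)
    then show "\<iota> x \<in> V"
      using U(3)[of \<one> x] W(3)[OF W(2) x] W(3)[OF x W(2)] by simp
  qed
qed

end

section \<open>Closures as inverse limits\<close>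

locale completed_inverse_system = two_sided_completed_group G T Gb Tb \<iota>
  for G :: "('a, 'm) monoid_scheme" (structure) and T
    and Gb :: "('b, 'n) monoid_scheme" and Tb \<iota> +
  fixes A :: "'a set" and I :: "'i::order set" and X :: "'i \<Rightarrow> 'c monoid"
    and b :: "'i \<Rightarrow> 'i \<Rightarrow> 'c \<Rightarrow> 'c" and p :: "'i \<Rightarrow> 'a \<Rightarrow> 'c"
  assumes A: "subgroup A G"
    and X: "\<And>i. i \<in> I \<Longrightarrow> group (X i)"
    and p: "\<And>i. i \<in> I \<Longrightarrow> p i \<in> hom (G\<lparr>carrier := A\<rparr>) (X i)"
    and p_onto: "\<And>i. i \<in> I \<Longrightarrow> p i ` A = carrier (X i)"
    and bond: "\<And>i j a. i \<in> I \<Longrightarrow> j \<in> I \<Longrightarrow> i \<le> j \<Longrightarrow> a \<in> A \<Longrightarrow> b i j (p j a) = p i a"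
    and directed: "\<And>i j. i \<in> I \<Longrightarrow> j \<in> I \<Longrightarrow> \<exists>k\<in>I. i \<le> k \<and> j \<le> k"
    and kernel_open: "\<And>i. i \<in> I \<Longrightarrow>
      \<exists>U. openin T U \<and> \<one> \<in> U \<and> (\<forall>a\<in>A \<inter> U. p i a = \<one>\<^bsub>X i\<^esub>)"
    and kernel_small: "\<And>U. openin T U \<Longrightarrow> \<one> \<in> U \<Longrightarrow>
      \<exists>i\<in>I. \<forall>a\<in>A. p i a = \<one>\<^bsub>X i\<^esub> \<longrightarrow> a \<in> U"
begin

section \<open>Fibres and the extension of the projections\<close>

definition "fibre i c = {a \<in> A. p i a = c}"
abbreviation "cl S \<equiv> Tb closure_of (\<iota> ` S)"
text \<open>All \<open>p i\<close> extended at once: a point of the closure gets the coordinate of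
  the fibre that it is a limit of. Existence of \<open>c\<close> comes from
  \<open>cl_fibre_locally_constant\<close>, uniqueness from \<open>cl_fibre_unique\<close>.\<close>

definition "limit_map x = (\<lambda>i\<in>I. THE c. x \<in> cl (fibre i c))"

lemma A_carrier: "a \<in> A \<Longrightarrow> a \<in> carrier G"
  using subgroup.mem_carrier[OF A] .

lemma p_mult: "i \<in> I \<Longrightarrow> a \<in> A \<Longrightarrow> a' \<in> A \<Longrightarrow> p i (a \<otimes> a') = p i a \<otimes>\<^bsub>X i\<^esub> p i a'"
  using p by (auto simp: hom_def)

lemma p_closed: "i \<in> I \<Longrightarrow> a \<in> A \<Longrightarrow> p i a \<in> carrier (X i)"
  using p by (auto simp: hom_def)

lemma p_inv:
  assumes "i \<in> I" "a \<in> A"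
  shows "p i (inv a) = inv\<^bsub>X i\<^esub> p i a"
proof -
  interpret p: group_hom "G\<lparr>carrier := A\<rparr>" "X i" "p i"
    using X p subgroup_imp_group[OF A] assms by (simp add: group_hom_def group_hom_axioms_def)
  show ?thesis using p.hom_inv[of a] assms by (simp add: m_inv_consistent[OF A])
qed

lemma p_eq_iff:
  assumes i: "i \<in> I" and a: "a \<in> A" and a': "a' \<in> A"
  shows "p i a = p i a' \<longleftrightarrow> p i (inv a \<otimes> a') = \<one>\<^bsub>X i\<^esub>"
    and "p i a = p i a' \<longleftrightarrow> p i (a \<otimes> inv a') = \<one>\<^bsub>X i\<^esub>"
proof -
  interpret Xi: group "X i" using X i .
  have c: "p i a \<in> carrier (X i)" "p i a' \<in> carrier (X i)" using p_closed assms by auto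
  show "p i a = p i a' \<longleftrightarrow> p i (inv a \<otimes> a') = \<one>\<^bsub>X i\<^esub>"
    using c assms
    by (auto simp: p_mult p_inv subgroup.m_inv_closed[OF A] Xi.inv_solve_left')
  show "p i a = p i a' \<longleftrightarrow> p i (a \<otimes> inv a') = \<one>\<^bsub>X i\<^esub>"
    using c assms
    by (auto simp: p_mult p_inv subgroup.m_inv_closed[OF A] Xi.inv_solve_right')
qed

text \<open>Near \<open>x\<close>, the element \<open>inv a \<otimes> a'\<close> is mapped to the
  quotient of \<open>x^-1 \<iota> a\<close> and \<open>x^-1 \<iota> a'\<close>, both in
  \<open>W\<close>. So its image lies in \<open>V\<close> and it lies itself in \<open>U\<close>,
  where \<open>p i\<close> is trivial.\<close>

lemma p_locally_constant:
  assumes x: "x \<in> carrier Gb" and i: "i \<in> I"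
  obtains V where "openin Tb V" "x \<in> V"
    "\<And>a a'. a \<in> A \<Longrightarrow> a' \<in> A \<Longrightarrow> \<iota> a \<in> V \<Longrightarrow> \<iota> a' \<in> V \<Longrightarrow> p i a = p i a'"
proof -
  obtain U where U: "openin T U" "\<one> \<in> U" "\<forall>a\<in>A \<inter> U. p i a = \<one>\<^bsub>X i\<^esub>"
    using kernel_open[OF i] by blast
  obtain V where V: "openin Tb V" "\<one>\<^bsub>Gb\<^esub> \<in> V" "\<And>a. a \<in> carrier G \<Longrightarrow> \<iota> a \<in> V \<Longrightarrow> a \<in> U"
    using nhd_pushforward[OF U(1,2)] by blast
  obtain W where W: "openin Tb W" "\<one>\<^bsub>Gb\<^esub> \<in> W"
    "\<And>a b. a \<in> W \<Longrightarrow> b \<in> W \<Longrightarrow> inv\<^bsub>Gb\<^esub> a \<otimes>\<^bsub>Gb\<^esub> b \<in> V"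
    using topological_group_symmetric_nhd[OF Tb V(1,2)] by blast
  show ?thesis
  proof (rule that)
    show "openin Tb {y \<in> carrier Gb. inv\<^bsub>Gb\<^esub> x \<otimes>\<^bsub>Gb\<^esub> y \<in> W}"
      using topological_group_openin_translate(1)[OF Tb W(1)] x by simp
    show "x \<in> {y \<in> carrier Gb. inv\<^bsub>Gb\<^esub> x \<otimes>\<^bsub>Gb\<^esub> y \<in> W}" using x W by simp
  next
    fix a a' assume a: "a \<in> A" "a' \<in> A"
      and "\<iota> a \<in> {y \<in> carrier Gb. inv\<^bsub>Gb\<^esub> x \<otimes>\<^bsub>Gb\<^esub> y \<in> W}"
        "\<iota> a' \<in> {y \<in> carrier Gb. inv\<^bsub>Gb\<^esub> x \<otimes>\<^bsub>Gb\<^esub> y \<in> W}"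
    then have "inv\<^bsub>Gb\<^esub> (inv\<^bsub>Gb\<^esub> x \<otimes>\<^bsub>Gb\<^esub> \<iota> a) \<otimes>\<^bsub>Gb\<^esub> (inv\<^bsub>Gb\<^esub> x \<otimes>\<^bsub>Gb\<^esub> \<iota> a') \<in> V"
      by (simp add: W(3))
    also have "inv\<^bsub>Gb\<^esub> (inv\<^bsub>Gb\<^esub> x \<otimes>\<^bsub>Gb\<^esub> \<iota> a) \<otimes>\<^bsub>Gb\<^esub> (inv\<^bsub>Gb\<^esub> x \<otimes>\<^bsub>Gb\<^esub> \<iota> a') = \<iota> (inv a \<otimes> a')"
      using x a by (simp add: Gb.inv_mult_group Gb.m_assoc Gb.inv_mult_cancel A_carrier)
    finally have "inv a \<otimes> a' \<in> U"
      using V(3) a by (simp add: A_carrier)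
    moreover have "inv a \<otimes> a' \<in> A"
      using a A by (simp add: subgroup.m_closed subgroup.m_inv_closed)
    ultimately show "p i a = p i a'"
      using U(3) p_eq_iff(1)[OF i a] by blast
  qed
qed

lemma cl_fibre_unique:
  assumes i: "i \<in> I" and "x \<in> cl (fibre i c)" "x \<in> cl (fibre i d)"
  shows "c = d"
proof -
  have "x \<in> carrier Gb" using assms(2) by (simp add: in_closure_of)
  then obtain V where V: "openin Tb V" "x \<in> V"
    "\<And>a a'. a \<in> A \<Longrightarrow> a' \<in> A \<Longrightarrow> \<iota> a \<in> V \<Longrightarrow> \<iota> a' \<in> V \<Longrightarrow> p i a = p i a'"
    using p_locally_constant i by blast
  obtain a a' where "a \<in> fibre i c" "\<iota> a \<in> V" "a' \<in> fibre i d" "\<iota> a' \<in> V"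
    by (metis closure_of_meets_open[OF assms(2) V(1,2)] closure_of_meets_open[OF assms(3) V(1,2)]
        imageE)
  then show ?thesis using V(3)[of a a'] by (auto simp: fibre_def)
qed

text \<open>Every neighbourhood of a point \<open>y\<close> of the closure can be cut down to
  \<open>V\<close>; it still meets the image of \<open>A\<close>, and all points of \<open>A\<close>
  mapped into \<open>V\<close> share the value \<open>p i a\<close>.\<close>

lemma cl_fibre_locally_constant:
  assumes i: "i \<in> I" and x: "x \<in> cl A"
  obtains V c where "openin Tb V" "x \<in> V" "c \<in> carrier (X i)"
    "\<And>y. y \<in> cl A \<Longrightarrow> y \<in> V \<Longrightarrow> y \<in> cl (fibre i c)"
proof -
  have "x \<in> carrier Gb" using x by (simp add: in_closure_of)
  then obtain V where V: "openin Tb V" "x \<in> V"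
    "\<And>a a'. a \<in> A \<Longrightarrow> a' \<in> A \<Longrightarrow> \<iota> a \<in> V \<Longrightarrow> \<iota> a' \<in> V \<Longrightarrow> p i a = p i a'"
    using p_locally_constant i by blast
  obtain a where a: "a \<in> A" "\<iota> a \<in> V"
    using closure_of_meets_open[OF x V(1,2)] by blast
  show ?thesis
  proof (rule that[OF V(1,2), of "p i a"])
    show "p i a \<in> carrier (X i)" using p_closed i a by simp
  next
    fix y assume y: "y \<in> cl A" "y \<in> V"
    show "y \<in> cl (fibre i (p i a))"
      unfolding in_closure_of
    proof (intro conjI allI impI)
      show "y \<in> topspace Tb" using y by (simp add: in_closure_of)
      fix W assume "y \<in> W \<and> openin Tb W"
      then obtain a' where "a' \<in> A" "\<iota> a' \<in> W \<inter> V"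
        using closure_of_meets_open[OF y(1), of "W \<inter> V"] y(2) V(1) by blast
      then show "\<exists>z. z \<in> \<iota> ` fibre i (p i a) \<and> z \<in> W"
        using V(3)[of a a'] a by (auto simp: fibre_def)
    qed
  qed
qed

lemma limit_map_iff:
  assumes i: "i \<in> I" and x: "x \<in> cl A"
  shows "limit_map x i = c \<longleftrightarrow> x \<in> cl (fibre i c)"
proof -
  obtain d where d: "x \<in> cl (fibre i d)"
    using cl_fibre_locally_constant[OF i x] x by metis
  have "limit_map x i = d"
    unfolding limit_map_def using i d cl_fibre_unique[OF i] by (auto intro!: the_equality)
  then show ?thesis using d cl_fibre_unique[OF i] by blast
qed

lemma limit_map_mem: "i \<in> I \<Longrightarrow> x \<in> cl A \<Longrightarrow> x \<in> cl (fibre i (limit_map x i))"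
  using limit_map_iff by blast

lemma fibre_subset: "fibre i c \<subseteq> A"
  by (auto simp: fibre_def)

lemma cl_fibre_subset: "cl (fibre i c) \<subseteq> cl A"
  by (intro closure_of_mono image_mono fibre_subset)

lemma limit_map_carrier:
  assumes i: "i \<in> I" and x: "x \<in> cl A"
  shows "limit_map x i \<in> carrier (X i)"
  using cl_fibre_locally_constant[OF i x] limit_map_iff[OF i x] x by metis

lemma limit_map_\<iota>:
  assumes "a \<in> A"
  shows "limit_map (\<iota> a) = (\<lambda>i\<in>I. p i a)"
proof
  fix i
  have "\<iota> a \<in> cl A" "\<iota> a \<in> cl (fibre i (p i a))"
    using assms A_carrier
    by (auto simp: fibre_def intro!: closure_of_subset[THEN subsetD])
  then show "limit_map (\<iota> a) i = (\<lambda>i\<in>I. p i a) i"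
    using limit_map_iff by (cases "i \<in> I") (auto simp: limit_map_def)
qed

lemma cl_mult:
  assumes "x \<in> cl S" "y \<in> cl S'" "S \<subseteq> carrier G" "S' \<subseteq> carrier G"
    and "\<And>a a'. a \<in> S \<Longrightarrow> a' \<in> S' \<Longrightarrow> a \<otimes> a' \<in> Z"
  shows "x \<otimes>\<^bsub>Gb\<^esub> y \<in> cl Z"
  by (rule topological_group_closure_of_mult[OF Tb assms(1,2)])
     (use assms(3-5) in \<open>auto simp: subset_iff simp flip: hom_mult\<close>)

lemma cl_inv_mult:
  assumes "x \<in> cl S" "y \<in> cl S'" "S \<subseteq> carrier G" "S' \<subseteq> carrier G"
    and "\<And>a a'. a \<in> S \<Longrightarrow> a' \<in> S' \<Longrightarrow> inv a \<otimes> a' \<in> Z"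
  shows "inv\<^bsub>Gb\<^esub> x \<otimes>\<^bsub>Gb\<^esub> y \<in> cl Z"
proof -
  have "(\<lambda>s. inv\<^bsub>Gb\<^esub> s) ` \<iota> ` S = \<iota> ` (\<lambda>s. inv s) ` S"
    using assms(3) by (force simp: subset_iff image_image)
  then have "inv\<^bsub>Gb\<^esub> x \<in> cl ((\<lambda>s. inv s) ` S)"
    using topological_group_closure_of_inv[OF Tb assms(1)] by simp
  then show ?thesis
    by (rule cl_mult[OF _ assms(2)]) (use assms(3-5) in auto)
qed

text \<open>The product of two fibres lies in the fibre over the product of the values, and this
  inclusion passes to closures.\<close>

lemma limit_map_mult:
  assumes "x \<in> cl A" "y \<in> cl A"
  shows "x \<otimes>\<^bsub>Gb\<^esub> y \<in> cl A"
    and "i \<in> I \<Longrightarrow> limit_map (x \<otimes>\<^bsub>Gb\<^esub> y) i = limit_map x i \<otimes>\<^bsub>X i\<^esub> limit_map y i"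
proof -
  show xy: "x \<otimes>\<^bsub>Gb\<^esub> y \<in> cl A"
    using cl_mult[OF assms] A subgroup.subset subgroup.m_closed by metis
  assume i: "i \<in> I"
  have "x \<otimes>\<^bsub>Gb\<^esub> y \<in> cl (fibre i (limit_map x i \<otimes>\<^bsub>X i\<^esub> limit_map y i))"
  proof (rule cl_mult[OF limit_map_mem[OF i assms(1)] limit_map_mem[OF i assms(2)]])
    show "a \<otimes> a' \<in> fibre i (limit_map x i \<otimes>\<^bsub>X i\<^esub> limit_map y i)"
      if "a \<in> fibre i (limit_map x i)" "a' \<in> fibre i (limit_map y i)" for a a'
      using that i subgroup.m_closed[OF A] p_mult by (auto simp: fibre_def)
  qed (use A_carrier in \<open>auto simp: fibre_def\<close>)
  then show "limit_map (x \<otimes>\<^bsub>Gb\<^esub> y) i = limit_map x i \<otimes>\<^bsub>X i\<^esub> limit_map y i"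
    using limit_map_iff[OF i xy] by blast
qed

lemma limit_map_compatible:
  assumes i: "i \<in> I" and j: "j \<in> I" and ij: "i \<le> j" and x: "x \<in> cl A"
  shows "b i j (limit_map x j) = limit_map x i"
proof -
  have "fibre j (limit_map x j) \<subseteq> fibre i (b i j (limit_map x j))"
    using bond[OF i j ij] by (force simp: fibre_def)
  then have "x \<in> cl (fibre i (b i j (limit_map x j)))"
    using limit_map_mem[OF j x] closure_of_mono[of "\<iota> ` fibre j (limit_map x j)"] by blast
  then show ?thesis using limit_map_iff[OF i x] by metis
qed

text \<open>Points of one fibre differ by elements of the kernel, which lies in \<open>U\<close>.
  Passing to closures costs only the step from \<open>W\<close> to its closure, and regularity keeps
  that inside \<open>V\<close>. Both injectivity and openness of \<open>limit_map\<close> rest on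
  this.\<close>

lemma limit_map_small:
  assumes V: "openin Tb V" "\<one>\<^bsub>Gb\<^esub> \<in> V"
  shows "\<exists>i\<in>I. \<forall>x\<in>cl A. \<forall>y\<in>cl A. limit_map x i = limit_map y i \<longrightarrow>
    inv\<^bsub>Gb\<^esub> x \<otimes>\<^bsub>Gb\<^esub> y \<in> V"
proof -
  obtain W where W: "openin Tb W" "\<one>\<^bsub>Gb\<^esub> \<in> W" "Tb closure_of W \<subseteq> V"
    using topological_group_regular[OF Tb V] by blast
  obtain U where U: "openin T U" "\<one> \<in> U" "\<And>x. x \<in> U \<Longrightarrow> \<iota> x \<in> W"
    using nhd_pullback[OF W(1,2)] by blast
  obtain i where i: "i \<in> I" "\<And>a. a \<in> A \<Longrightarrow> p i a = \<one>\<^bsub>X i\<^esub> \<Longrightarrow> a \<in> U"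
    using kernel_small[OF U(1,2)] by blast
  show ?thesis
  proof (intro bexI[OF _ i(1)] ballI impI)
    fix x y assume xy: "x \<in> cl A" "y \<in> cl A" "limit_map x i = limit_map y i"
    have "inv\<^bsub>Gb\<^esub> x \<otimes>\<^bsub>Gb\<^esub> y \<in> cl U"
    proof (rule cl_inv_mult)
      show "x \<in> cl (fibre i (limit_map x i))" "y \<in> cl (fibre i (limit_map x i))"
        using limit_map_mem[OF i(1) xy(1)] limit_map_mem[OF i(1) xy(2)] by (simp_all only: xy(3))
      show "inv a \<otimes> a' \<in> U"
        if "a \<in> fibre i (limit_map x i)" "a' \<in> fibre i (limit_map x i)" for a a'
        using that i p_eq_iff(1)[OF i(1), of a a'] A
        by (auto simp: fibre_def subgroup.m_closed subgroup.m_inv_closed)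
    qed (use A_carrier in \<open>auto simp: fibre_def\<close>)
    moreover have "cl U \<subseteq> Tb closure_of W" using U(3) by (intro closure_of_mono) auto
    ultimately show "inv\<^bsub>Gb\<^esub> x \<otimes>\<^bsub>Gb\<^esub> y \<in> V" using W(3) by blast
  qed
qed

lemma limit_map_inj:
  assumes xy: "x \<in> cl A" "y \<in> cl A" and eq: "limit_map x = limit_map y"
  shows "x = y"
proof (rule ccontr)
  assume "x \<noteq> y"
  have c: "x \<in> carrier Gb" "y \<in> carrier Gb" using xy by (auto simp: in_closure_of)
  have ne: "inv\<^bsub>Gb\<^esub> x \<otimes>\<^bsub>Gb\<^esub> y \<noteq> \<one>\<^bsub>Gb\<^esub>"
    using c \<open>x \<noteq> y\<close> Gb.inv_solve_left' by force
  \<comment> \<open>The quotient of the two points is separated from the identity, instead of the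
    points from each other, because \<open>limit_map_small\<close> speaks of neighbourhoods of the
    identity.\<close>
  have "Hausdorff_space Tb" using completion by (simp add: two_sided_completion_def)
  then obtain V V' where "openin Tb V" "\<one>\<^bsub>Gb\<^esub> \<in> V" "inv\<^bsub>Gb\<^esub> x \<otimes>\<^bsub>Gb\<^esub> y \<in> V'" "disjnt V V'"
    using ne c unfolding Hausdorff_space_def
    by (metis Gb.inv_closed Gb.m_closed Gb.one_closed topspace_Tb)
  moreover from this have "inv\<^bsub>Gb\<^esub> x \<otimes>\<^bsub>Gb\<^esub> y \<in> V"
    using limit_map_small[of V] xy eq by auto
  ultimately show False using eq by (auto simp: disjnt_iff)
qed

section \<open>Surjectivity and the topology of the limit\<close>

lemma index_nonempty: "I \<noteq> {}"
proof -
  have "openin T (carrier G)"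
    using T openin_topspace[of T] by (simp add: topological_group_def)
  then show ?thesis using kernel_small by blast
qed

lemma inverse_limit_carrier:
  "x \<in> carrier (inverse_limit I X b) \<longleftrightarrow>
     x \<in> (\<Pi>\<^sub>E i\<in>I. carrier (X i)) \<and> (\<forall>i\<in>I. \<forall>j\<in>I. i \<le> j \<longrightarrow> b i j (x j) = x i)"
  by (simp add: inverse_limit_def)

lemma limit_map_in_limit:
  assumes "x \<in> cl A"
  shows "limit_map x \<in> carrier (inverse_limit I X b)"
  using assms limit_map_compatible limit_map_carrier
  by (auto simp: inverse_limit_carrier PiE_def extensional_def limit_map_def)

lemma limit_map_onto:
  assumes c: "c \<in> carrier (inverse_limit I X b)"
  obtains x where "x \<in> cl A" "limit_map x = c"
proof -
  let ?f = "\<lambda>i. \<iota> ` fibre i (c i)"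
  let ?F = "INF i\<in>I. principal (?f i)"
  have mono: "fibre j (c j) \<subseteq> fibre i (c i)" if ij: "i \<in> I" "j \<in> I" "i \<le> j" for i j
    using bond[OF ij] ij c by (force simp: inverse_limit_carrier fibre_def)
  have dir: "\<exists>k\<in>I. principal (?f k) \<le> inf (principal (?f i)) (principal (?f j))"
    if "i \<in> I" "j \<in> I" for i j
  proof -
    obtain k where "k \<in> I" "i \<le> k" "j \<le> k" using directed \<open>i \<in> I\<close> \<open>j \<in> I\<close> by blast
    then show ?thesis
      using mono[OF that(1), of k] mono[OF that(2), of k] by (intro bexI[of _ k]) auto
  qed
  have ev: "eventually P ?F \<longleftrightarrow> (\<exists>i\<in>I. \<forall>a\<in>fibre i (c i). P (\<iota> a))" for P
  proof -
    have "eventually P ?F \<longleftrightarrow> (\<exists>i\<in>I. eventually P (principal (?f i)))"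
      by (rule eventually_INF_base[OF index_nonempty dir])
    then show ?thesis by (simp add: eventually_principal)
  qed
  have ne: "fibre i (c i) \<noteq> {}" if "i \<in> I" for i
    using p_onto[OF that] c that by (force simp: inverse_limit_carrier fibre_def PiE_def Pi_def)
  have "?F \<noteq> bot"
    unfolding trivial_limit_def ev using ne by blast
  moreover have "?F \<le> principal (carrier Gb)"
    unfolding le_principal ev using index_nonempty A_carrier by (auto simp: fibre_def)
  moreover have "?F \<times>\<^sub>F ?F \<le> two_sided_uniformity Gb Tb"
  proof (rule filter_leI)
    fix P assume "eventually P (two_sided_uniformity Gb Tb)"
    then obtain V where V: "openin Tb V" "\<one>\<^bsub>Gb\<^esub> \<in> V"
      "\<And>x y. x \<in> carrier Gb \<Longrightarrow> y \<in> carrier Gb \<Longrightarrow> inv\<^bsub>Gb\<^esub> x \<otimes>\<^bsub>Gb\<^esub> y \<in> V \<Longrightarrow>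
         x \<otimes>\<^bsub>Gb\<^esub> inv\<^bsub>Gb\<^esub> y \<in> V \<Longrightarrow> P (x, y)"
      unfolding eventually_two_sided_uniformity[OF Tb] by blast
    obtain U where U: "openin T U" "\<one> \<in> U" "\<And>x. x \<in> U \<Longrightarrow> \<iota> x \<in> V"
      using nhd_pullback[OF V(1,2)] by blast
    obtain i where i: "i \<in> I" "\<And>a. a \<in> A \<Longrightarrow> p i a = \<one>\<^bsub>X i\<^esub> \<Longrightarrow> a \<in> U"
      using kernel_small[OF U(1,2)] by blast
    have "P (\<iota> a, \<iota> a')" if "a \<in> fibre i (c i)" "a' \<in> fibre i (c i)" for a a'
    proof -
      have a: "a \<in> A" "a' \<in> A" "p i a = p i a'" using that by (auto simp: fibre_def)
      \<comment> \<open>Members of one fibre differ by kernel elements on the left and on the right,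
        as the two forms of \<open>p_eq_iff\<close> show; a two-sided entourage requires
        both.\<close>
      then have "\<iota> (inv a \<otimes> a') \<in> V" "\<iota> (a \<otimes> inv a') \<in> V"
        using p_eq_iff[OF i(1) a(1,2)] A
        by (auto intro!: U i simp: subgroup.m_closed subgroup.m_inv_closed)
      then show ?thesis using a by (intro V) (auto simp: A_carrier)
    qed
    then show "eventually P (?F \<times>\<^sub>F ?F)"
      unfolding eventually_prod_filter ev using i(1)
      by (intro exI[of _ "\<lambda>y. y \<in> ?f i"] conjI) auto
  qed
  ultimately obtain x where x: "x \<in> carrier Gb" "?F \<le> nhdsin Tb x"
    using completion unfolding two_sided_completion_def two_sided_complete_def by meson
  \<comment> \<open>A limit of the filter is a cluster point: \<open>V\<close> contains the image of
    some fibre over \<open>j\<close>, and for an upper bound \<open>k\<close> of \<open>i\<close>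
    and \<open>j\<close> the fibre over \<open>k\<close> is nonempty and lies in both.\<close>
  have cl: "x \<in> cl (fibre i (c i))" if i: "i \<in> I" for i
    unfolding in_closure_of
  proof (intro conjI allI impI)
    show "x \<in> topspace Tb" using x by simp
    fix V assume V: "x \<in> V \<and> openin Tb V"
    have "eventually (\<lambda>y. y \<in> V) (nhdsin Tb x)"
      using V x by (auto simp: eventually_nhdsin)
    then have "eventually (\<lambda>y. y \<in> V) ?F" using x(2) by (rule filter_leD[rotated])
    then obtain j where j: "j \<in> I" "\<forall>a\<in>fibre j (c j). \<iota> a \<in> V"
      unfolding ev by blast
    obtain k where k: "k \<in> I" "i \<le> k" "j \<le> k" using directed[OF i j(1)] by blast
    then show "\<exists>y. y \<in> \<iota> ` fibre i (c i) \<and> y \<in> V"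
      using ne[OF k(1)] mono[OF i k(1,2)] mono[OF j(1) k(1,3)] j(2) by blast
  qed
  obtain i0 where "i0 \<in> I" using index_nonempty by blast
  then have xA: "x \<in> cl A" by (rule subsetD[OF cl_fibre_subset cl])
  moreover have "limit_map x = c"
  proof
    fix i show "limit_map x i = c i"
    proof (cases "i \<in> I")
      case True
      then show ?thesis using limit_map_iff[OF True xA] cl[OF True] by simp
    next
      case False
      \<comment> \<open>Off \<open>I\<close> both functions have the default value
        \<open>undefined\<close>, so they agree as total functions.\<close>
      moreover have "c i = undefined"
        using c PiE_arb[OF _ False] by (simp only: inverse_limit_carrier) blast
      ultimately show ?thesis by (simp add: limit_map_def)
    qed
  qed
  ultimately show ?thesis by (rule that)
qed

text \<open>Each coordinate is locally constant on the closure, so the preimage of any set of values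
  is open.\<close>

lemma limit_map_continuous:
  "continuous_map (subtopology Tb (cl A)) (inverse_limit_topology I X b) limit_map"
proof -
  have "openin (subtopology Tb (cl A)) {x \<in> cl A. limit_map x i \<in> S}" if i: "i \<in> I" for i S
    unfolding openin_subopen[of _ "{x \<in> cl A. limit_map x i \<in> S}"]
  proof
    fix x assume "x \<in> {x \<in> cl A. limit_map x i \<in> S}"
    then have x: "x \<in> cl A" "limit_map x i \<in> S" by auto
    obtain V c where V: "openin Tb V" "x \<in> V" "\<And>y. y \<in> cl A \<Longrightarrow> y \<in> V \<Longrightarrow> y \<in> cl (fibre i c)"
      using cl_fibre_locally_constant[OF i x(1)] by metis
    then have "limit_map y i = c" if "y \<in> cl A" "y \<in> V" for y
      using that limit_map_iff[OF i] by blast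
    then have "V \<inter> cl A \<subseteq> {x \<in> cl A. limit_map x i \<in> S}"
      using x V(2) by auto
    moreover have "openin (subtopology Tb (cl A)) (V \<inter> cl A)"
      using V(1) by (auto simp: openin_subtopology)
    ultimately show "\<exists>T. openin (subtopology Tb (cl A)) T \<and> x \<in> T \<and>
        T \<subseteq> {x \<in> cl A. limit_map x i \<in> S}"
      using x V(2) by blast
  qed
  then have "continuous_map (subtopology Tb (cl A)) (discrete_topology (carrier (X i)))
      (\<lambda>x. limit_map x i)" if "i \<in> I" for i
    using that limit_map_carrier closure_of_subset_topspace[of Tb "\<iota> ` A"]
    by (auto simp: continuous_map_def Int_absorb1)
  then show ?thesis
    using limit_map_in_limit
    by (auto simp: inverse_limit_topology_def continuous_map_in_subtopology
        continuous_map_componentwise inverse_limit_carrier PiE_def)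
qed

text \<open>Apply \<open>limit_map_small\<close> to the translate of \<open>V\<close> that moves
  \<open>x\<close> to the identity: it yields an index \<open>i\<close> such that fixing the
  \<open>i\<close>-th coordinate already forces a point into \<open>V\<close>. Fixing one coordinate
  is an open condition in the limit, and surjectivity provides a preimage for every element
  satisfying it.\<close>

lemma limit_map_open:
  "open_map (subtopology Tb (cl A)) (inverse_limit_topology I X b) limit_map"
  unfolding open_map_def
proof (intro allI impI)
  fix S assume "openin (subtopology Tb (cl A)) S"
  then obtain V where V: "openin Tb V" "S = V \<inter> cl A" by (auto simp: openin_subtopology)
  show "openin (inverse_limit_topology I X b) (limit_map ` S)"
    unfolding openin_subopen[of _ "limit_map ` S"]
  proof
    fix c assume "c \<in> limit_map ` S"
    then obtain x where x: "x \<in> V" "x \<in> cl A" "c = limit_map x" using V by blast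
    then have xc: "x \<in> carrier Gb" by (simp add: in_closure_of)
    let ?W = "{y \<in> carrier Gb. x \<otimes>\<^bsub>Gb\<^esub> y \<in> V}"
    have "openin Tb ?W"
      by (rule topological_group_openin_translate(1)[OF Tb V(1) xc])
    moreover have "\<one>\<^bsub>Gb\<^esub> \<in> ?W" using x xc by simp
    ultimately have "\<exists>i\<in>I. \<forall>x\<in>cl A. \<forall>y\<in>cl A. limit_map x i = limit_map y i \<longrightarrow>
        inv\<^bsub>Gb\<^esub> x \<otimes>\<^bsub>Gb\<^esub> y \<in> ?W"
      by (rule limit_map_small)
    then obtain i where i: "i \<in> I" "\<forall>x\<in>cl A. \<forall>y\<in>cl A. limit_map x i = limit_map y i \<longrightarrow>
        inv\<^bsub>Gb\<^esub> x \<otimes>\<^bsub>Gb\<^esub> y \<in> ?W" by (rule bexE)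
    have inV: "y \<in> V" if y: "y \<in> cl A" "limit_map x i = limit_map y i" for y
    proof -
      have "y \<in> carrier Gb" using y by (simp add: in_closure_of)
      then show ?thesis using i(2) y x(2) xc by (force simp: Gb.inv_mult_cancel)
    qed
    let ?D = "{d \<in> carrier (inverse_limit I X b). d i = c i}"
    let ?P = "product_topology (\<lambda>i. discrete_topology (carrier (X i))) I"
    have "openin ?P {d \<in> topspace ?P. d i \<in> {c i}}"
      by (rule openin_continuous_map_preimage[OF continuous_map_product_projection[OF i(1)]])
        (use limit_map_carrier[OF i(1)] x in simp)
    then have "openin (inverse_limit_topology I X b)
        ({d \<in> topspace ?P. d i \<in> {c i}} \<inter> carrier (inverse_limit I X b))"
      unfolding inverse_limit_topology_def openin_subtopology by blast
    also have "{d \<in> topspace ?P. d i \<in> {c i}} \<inter> carrier (inverse_limit I X b) = ?D"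
      by (auto simp: inverse_limit_carrier)
    finally have "openin (inverse_limit_topology I X b) ?D" .
    moreover have "c \<in> ?D" using x limit_map_in_limit by simp
    moreover have "?D \<subseteq> limit_map ` S"
    proof
      fix d assume d: "d \<in> ?D"
      then obtain y where "y \<in> cl A" "limit_map y = d" using limit_map_onto by blast
      then show "d \<in> limit_map ` S" using inV d V x by auto
    qed
    ultimately show "\<exists>D. openin (inverse_limit_topology I X b) D \<and> c \<in> D \<and> D \<subseteq> limit_map ` S"
      by blast
  qed
qed

theorem closure_iso_inverse_limit:
  "\<exists>\<phi>. topological_group_iso (Gb\<lparr>carrier := cl A\<rparr>) (subtopology Tb (cl A))
         (inverse_limit I X b) (inverse_limit_topology I X b) \<phi> \<and>
       (\<forall>a\<in>A. \<phi> (\<iota> a) = (\<lambda>i\<in>I. p i a))"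
proof (intro exI conjI ballI)
  have top: "topspace (subtopology Tb (cl A)) = cl A"
    using closure_of_subset_topspace[of Tb "\<iota> ` A"] by auto
  have topl: "topspace (inverse_limit_topology I X b) = carrier (inverse_limit I X b)"
    by (auto simp: inverse_limit_topology_def inverse_limit_carrier)
  have img: "limit_map ` cl A = carrier (inverse_limit I X b)"
    using limit_map_in_limit limit_map_onto by blast
  have inj: "inj_on limit_map (cl A)" using limit_map_inj by (auto intro!: inj_onI)
  have "limit_map \<in> hom (Gb\<lparr>carrier := cl A\<rparr>) (inverse_limit I X b)"
  proof (rule homI)
    show "limit_map x \<in> carrier (inverse_limit I X b)" if "x \<in> carrier (Gb\<lparr>carrier := cl A\<rparr>)" for x
      using that limit_map_in_limit by simp
    show "limit_map (x \<otimes>\<^bsub>Gb\<lparr>carrier := cl A\<rparr>\<^esub> y) = limit_map x \<otimes>\<^bsub>inverse_limit I X b\<^esub> limit_map y"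
      if "x \<in> carrier (Gb\<lparr>carrier := cl A\<rparr>)" "y \<in> carrier (Gb\<lparr>carrier := cl A\<rparr>)" for x y
      using that limit_map_mult(2)[of x y]
      by (auto simp: inverse_limit_def fun_eq_iff limit_map_def[of "x \<otimes>\<^bsub>Gb\<^esub> y"])
  qed
  moreover have "homeomorphic_map (subtopology Tb (cl A)) (inverse_limit_topology I X b) limit_map"
    using limit_map_continuous limit_map_open img inj
    by (intro bijective_open_imp_homeomorphic_map) (simp_all only: top topl)
  ultimately show "topological_group_iso (Gb\<lparr>carrier := cl A\<rparr>) (subtopology Tb (cl A))
     (inverse_limit I X b) (inverse_limit_topology I X b) limit_map"
    using img inj by (simp add: topological_group_iso_def iso_def bij_betw_def)
qed (rule limit_map_\<iota>)

end

section \<open>Conjugation and quotients of subgroups\<close>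

context group
begin

text \<open>A right action: \<open>a \<in> conjugate G x A\<close> turns into
  \<open>conj_by x a \<in> A\<close>, and for a product the left factor acts first.\<close>

definition conj_by :: "'a \<Rightarrow> 'a \<Rightarrow> 'a" where
  "conj_by x a = inv x \<otimes> a \<otimes> x"

lemma conj_by_closed [simp]: "x \<in> carrier G \<Longrightarrow> a \<in> carrier G \<Longrightarrow> conj_by x a \<in> carrier G"
  by (simp add: conj_by_def)

lemma conj_by_one [simp]: "a \<in> carrier G \<Longrightarrow> conj_by \<one> a = a" "x \<in> carrier G \<Longrightarrow> conj_by x \<one> = \<one>"
  by (simp_all add: conj_by_def)

lemma conj_by_mult:
  "x \<in> carrier G \<Longrightarrow> a \<in> carrier G \<Longrightarrow> b \<in> carrier G \<Longrightarrow>
     conj_by x (a \<otimes> b) = conj_by x a \<otimes> conj_by x b"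
  by (simp add: conj_by_def m_assoc inv_mult_cancel)

lemma conj_by_inv:
  "x \<in> carrier G \<Longrightarrow> a \<in> carrier G \<Longrightarrow> conj_by x (inv a) = inv (conj_by x a)"
  by (simp add: conj_by_def m_assoc inv_mult_group)

lemma conj_by_comp:
  "x \<in> carrier G \<Longrightarrow> y \<in> carrier G \<Longrightarrow> a \<in> carrier G \<Longrightarrow>
     conj_by (x \<otimes> y) a = conj_by y (conj_by x a)"
  by (simp add: conj_by_def m_assoc inv_mult_group)

lemma conj_by_cancel:
  "x \<in> carrier G \<Longrightarrow> a \<in> carrier G \<Longrightarrow> conj_by (inv x) (conj_by x a) = a"
  "x \<in> carrier G \<Longrightarrow> a \<in> carrier G \<Longrightarrow> conj_by x (conj_by (inv x) a) = a"
  by (simp_all flip: conj_by_comp)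

lemma conj_by_subgroup:
  "subgroup A G \<Longrightarrow> x \<in> A \<Longrightarrow> a \<in> A \<Longrightarrow> conj_by x a \<in> A"
  by (simp add: conj_by_def subgroup.m_closed subgroup.m_inv_closed)

text \<open>Both families have this shape: \<open>M_sub\<close> with \<open>M\<close> for
  \<open>A\<close> and \<open>B\<close>, and \<open>R_sub\<close> with \<open>R\<close> for
  \<open>A\<close> and \<open>H\<close> for \<open>B\<close>.\<close>

lemma subgroup_conj_by_mem:
  assumes A: "subgroup A G" and B: "subgroup B G" and S: "S \<subseteq> carrier G"
  shows "subgroup {a \<in> A. \<forall>x\<in>S. conj_by x a \<in> B} G"
proof (rule subgroupI)
  show "{a \<in> A. \<forall>x\<in>S. conj_by x a \<in> B} \<subseteq> carrier G" using subgroup.subset[OF A] by blast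
  have "\<one> \<in> {a \<in> A. \<forall>x\<in>S. conj_by x a \<in> B}"
    using subgroup.one_closed[OF A] subgroup.one_closed[OF B] S by auto
  then show "{a \<in> A. \<forall>x\<in>S. conj_by x a \<in> B} \<noteq> {}" by blast
next
  fix a assume "a \<in> {a \<in> A. \<forall>x\<in>S. conj_by x a \<in> B}"
  then show "inv a \<in> {a \<in> A. \<forall>x\<in>S. conj_by x a \<in> B}"
    using subgroup.m_inv_closed[OF A] subgroup.m_inv_closed[OF B] subgroup.mem_carrier[OF A] S
    by (auto simp: conj_by_inv subset_iff)
next
  fix a b assume "a \<in> {a \<in> A. \<forall>x\<in>S. conj_by x a \<in> B}" "b \<in> {a \<in> A. \<forall>x\<in>S. conj_by x a \<in> B}"
  then show "a \<otimes> b \<in> {a \<in> A. \<forall>x\<in>S. conj_by x a \<in> B}"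
    using subgroup.m_closed[OF A] subgroup.m_closed[OF B] subgroup.mem_carrier[OF A] S
    by (auto simp: conj_by_mult subset_iff)
qed

lemma mem_conjugate_iff_conj_by:
  "x \<in> carrier G \<Longrightarrow> A \<subseteq> carrier G \<Longrightarrow> a \<in> conjugate G x A \<longleftrightarrow> a \<in> carrier G \<and> conj_by x a \<in> A"
  by (simp add: mem_conjugate_iff conj_by_def)

lemma mem_l_coset_iff:
  assumes "A \<subseteq> carrier G" "x \<in> carrier G"
  shows "a \<in> x <#\<^bsub>G\<^esub> A \<longleftrightarrow> a \<in> carrier G \<and> inv x \<otimes> a \<in> A"
proof
  assume "a \<in> x <#\<^bsub>G\<^esub> A"
  then obtain h where "h \<in> A" "a = x \<otimes> h" by (auto simp: l_coset_def)
  then show "a \<in> carrier G \<and> inv x \<otimes> a \<in> A" using assms by (auto simp: inv_mult_cancel subset_iff)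
next
  assume a: "a \<in> carrier G \<and> inv x \<otimes> a \<in> A"
  then have "a = x \<otimes> (inv x \<otimes> a)" using assms by (simp add: inv_mult_cancel)
  then show "a \<in> x <#\<^bsub>G\<^esub> A" using a unfolding l_coset_def by blast
qed

lemma subgroup_inv_mem_iff:
  assumes K: "subgroup K G" and x: "x \<in> carrier G"
  shows "inv x \<in> K \<longleftrightarrow> x \<in> K"
  using subgroup.m_inv_closed[OF K, of x] subgroup.m_inv_closed[OF K, of "inv x"] x by auto

lemma l_coset_memI: "h \<in> A \<Longrightarrow> x \<otimes> h \<in> x <#\<^bsub>G\<^esub> A"
  by (auto simp: l_coset_def)

lemma set_mult_memI: "a \<in> A \<Longrightarrow> b \<in> B \<Longrightarrow> a \<otimes> b \<in> A <#>\<^bsub>G\<^esub> B"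
  by (auto simp: set_mult_def)

lemma normal_in_subgroupI:
  assumes A: "subgroup A G" and K: "subgroup K G" and "K \<subseteq> A"
    and conj: "\<And>a k. a \<in> A \<Longrightarrow> k \<in> K \<Longrightarrow> conj_by a k \<in> K"
  shows "K \<lhd> G\<lparr>carrier := A\<rparr>"
proof -
  interpret A: group "G\<lparr>carrier := A\<rparr>" using subgroup_imp_group[OF A] .
  have "a \<otimes> k \<otimes> inv a \<in> K" if "a \<in> A" "k \<in> K" for a k
    using conj[of "inv a" k] that subgroup.m_inv_closed[OF A] subgroup.mem_carrier[OF A]
    by (simp add: conj_by_def)
  then show ?thesis
    unfolding A.normal_inv_iff
    using subgroup_incl[OF K A \<open>K \<subseteq> A\<close>] by (simp add: m_inv_consistent[OF A])
qed

lemma quotient_in_subgroup: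
  assumes A: "subgroup A G" and K: "K \<lhd> G\<lparr>carrier := A\<rparr>"
  shows "group (G\<lparr>carrier := A\<rparr> Mod K)"
    and "(\<lambda>a. K #> a) \<in> hom (G\<lparr>carrier := A\<rparr>) (G\<lparr>carrier := A\<rparr> Mod K)"
    and "(\<lambda>a. K #> a) ` A = carrier (G\<lparr>carrier := A\<rparr> Mod K)"
    and "a \<in> A \<Longrightarrow> K #> a = \<one>\<^bsub>G\<lparr>carrier := A\<rparr> Mod K\<^esub> \<longleftrightarrow> a \<in> K"
proof -
  interpret K: normal K "G\<lparr>carrier := A\<rparr>" using K .
  have KG: "subgroup K G" using incl_subgroup[OF A] K.subgroup_axioms .
  show "group (G\<lparr>carrier := A\<rparr> Mod K)" by (rule K.factorgroup_is_group)
  show "(\<lambda>a. K #> a) \<in> hom (G\<lparr>carrier := A\<rparr>) (G\<lparr>carrier := A\<rparr> Mod K)"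
    using K.r_coset_hom_Mod by (simp add: r_coset_def)
  show "(\<lambda>a. K #> a) ` A = carrier (G\<lparr>carrier := A\<rparr> Mod K)"
    by (auto simp: FactGroup_def RCOSETS_def r_coset_def)
  show "K #> a = \<one>\<^bsub>G\<lparr>carrier := A\<rparr> Mod K\<^esub> \<longleftrightarrow> a \<in> K" if "a \<in> A"
    using that KG subgroup.mem_carrier[OF A that] rcos_self[of a K]
    by (auto simp: FactGroup_def coset_join2 dest: coset_join1[rotated])
qed

text \<open>Computes the bonding maps: since \<open>K\<close> absorbs \<open>K'\<close>, the coset
  of \<open>a\<close> modulo \<open>K'\<close> goes to its coset modulo \<open>K\<close>.\<close>

lemma set_mult_r_coset_absorb:
  assumes K: "subgroup K G" and K': "subgroup K' G" and "K' \<subseteq> K" "a \<in> carrier G"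
  shows "K <#>\<^bsub>G\<^esub> (K' #> a) = K #> a"
proof -
  have "K <#>\<^bsub>G\<^esub> K' = K"
  proof
    show "K <#>\<^bsub>G\<^esub> K' \<subseteq> K"
      using subgroup.m_closed[OF K] \<open>K' \<subseteq> K\<close> by (auto simp: set_mult_def)
    have "k = k \<otimes> \<one>" if "k \<in> K" for k using subgroup.mem_carrier[OF K that] by simp
    then show "K \<subseteq> K <#>\<^bsub>G\<^esub> K'"
      using subgroup.one_closed[OF K'] unfolding set_mult_def by blast
  qed
  then show ?thesis
    using setmult_rcos_assoc[of K K' a] subgroup.subset[OF K] subgroup.subset[OF K'] assms(4) by simp
qed

end

text \<open>Serves \<open>M\<close>, \<open>N\<close> and \<open>R\<close>. Openness of
  \<open>K i\<close> is asked only relative to \<open>A\<close>, as a trace condition on some open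
  set of \<open>G\<close>.\<close>

theorem (in two_sided_completed_group) closure_iso_inverse_limit_quotients:
  fixes I :: "'i::order set"
  assumes A: "subgroup A G"
    and K: "\<And>i. i \<in> I \<Longrightarrow> K i \<lhd> G\<lparr>carrier := A\<rparr>"
    and mono: "\<And>i j. i \<in> I \<Longrightarrow> j \<in> I \<Longrightarrow> i \<le> j \<Longrightarrow> K j \<subseteq> K i"
    and directed: "\<And>i j. i \<in> I \<Longrightarrow> j \<in> I \<Longrightarrow> \<exists>k\<in>I. i \<le> k \<and> j \<le> k"
    and kernel_open: "\<And>i. i \<in> I \<Longrightarrow> \<exists>U. openin T U \<and> \<one> \<in> U \<and> A \<inter> U \<subseteq> K i"
    and kernel_small: "\<And>U. openin T U \<Longrightarrow> \<one> \<in> U \<Longrightarrow> \<exists>i\<in>I. K i \<subseteq> U"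
  shows "\<exists>\<phi>. topological_group_iso
           (Gb\<lparr>carrier := Tb closure_of (\<iota> ` A)\<rparr>) (subtopology Tb (Tb closure_of (\<iota> ` A)))
           (inverse_limit I (\<lambda>i. G\<lparr>carrier := A\<rparr> Mod K i) (\<lambda>i j C. K i <#> C))
           (inverse_limit_topology I (\<lambda>i. G\<lparr>carrier := A\<rparr> Mod K i) (\<lambda>i j C. K i <#> C)) \<phi> \<and>
         (\<forall>a\<in>A. \<phi> (\<iota> a) = (\<lambda>i\<in>I. K i #> a))"
proof -
  have KG: "subgroup (K i) G" if "i \<in> I" for i
    using incl_subgroup[OF A normal_imp_subgroup[OF K[OF that]]] .
  interpret completed_inverse_system G T Gb Tb \<iota> A I "\<lambda>i. G\<lparr>carrier := A\<rparr> Mod K i"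
    "\<lambda>i j C. K i <#> C" "\<lambda>i a. K i #> a"
  proof (intro completed_inverse_system.intro completed_inverse_system_axioms.intro
      two_sided_completed_group_axioms)
    show "K i <#> (K j #> a) = K i #> a" if "i \<in> I" "j \<in> I" "i \<le> j" "a \<in> A" for i j a
      using that set_mult_r_coset_absorb[OF KG KG mono] subgroup.mem_carrier[OF A] by blast
    show "\<exists>U. openin T U \<and> \<one> \<in> U \<and> (\<forall>a\<in>A \<inter> U. K i #> a = \<one>\<^bsub>G\<lparr>carrier := A\<rparr> Mod K i\<^esub>)"
      if "i \<in> I" for i
      using kernel_open[OF that] quotient_in_subgroup(4)[OF A K[OF that]] by blast
    show "\<exists>i\<in>I. \<forall>a\<in>A. K i #> a = \<one>\<^bsub>G\<lparr>carrier := A\<rparr> Mod K i\<^esub> \<longrightarrow> a \<in> U"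
      if "openin T U" "\<one> \<in> U" for U
      using kernel_small[OF that] quotient_in_subgroup(4)[OF A K] by blast
  qed (use A directed quotient_in_subgroup(1-3)[OF A K] in simp_all)
  show ?thesis by (rule closure_iso_inverse_limit)
qed

section \<open>Hecke pairs of semidirect products\<close>

locale semidirect_hecke_pair = group G
  for G :: "('a, 'm) monoid_scheme" (structure) +
  fixes N Q M R H :: "'a set"
  assumes N: "N \<lhd> G" and Q: "subgroup Q G"
    and NQ: "N \<inter> Q = {\<one>}" "N <#> Q = carrier G"
    and M: "M \<lhd> (G\<lparr>carrier := N\<rparr>)"
    and R: "subgroup R (G\<lparr>carrier := Q\<rparr>)"
    and R_normalizes_M: "\<And>r. r \<in> R \<Longrightarrow> conjugate G r M = M"
    and H: "H = M <#> R"
    and hecke: "hecke_pair G H"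
begin

lemma subgroups:
  "subgroup N G" "subgroup M G" "subgroup R G" "subgroup H G"
  using normal_imp_subgroup[OF N] incl_subgroup[OF _ normal_imp_subgroup[OF M]]
    incl_subgroup[OF Q R] hecke by (auto simp: hecke_pair_def)

lemma subsets: "M \<subseteq> N" "R \<subseteq> Q" "M \<subseteq> H" "R \<subseteq> H"
proof -
  show MN: "M \<subseteq> N" using normal_imp_subgroup[OF M] subgroup.subset by force
  show RQ: "R \<subseteq> Q" using R subgroup.subset by force
  have m: "m \<otimes> \<one> = m" if "m \<in> M" for m using that subgroup.mem_carrier[OF subgroups(2)] by simp
  have r: "\<one> \<otimes> r = r" if "r \<in> R" for r using that subgroup.mem_carrier[OF subgroups(3)] by simp
  show "M \<subseteq> H" "R \<subseteq> H"
    using m r subgroup.one_closed[OF subgroups(2)] subgroup.one_closed[OF subgroups(3)]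
    unfolding H set_mult_def by (auto 0 3)
qed

lemma carriers [simp]:
  "a \<in> N \<Longrightarrow> a \<in> carrier G" "a \<in> Q \<Longrightarrow> a \<in> carrier G" "a \<in> M \<Longrightarrow> a \<in> carrier G"
  "a \<in> R \<Longrightarrow> a \<in> carrier G" "a \<in> H \<Longrightarrow> a \<in> carrier G"
  using subgroup.mem_carrier Q subgroups by metis+

lemma ones [simp]: "\<one> \<in> N" "\<one> \<in> Q" "\<one> \<in> M" "\<one> \<in> R" "\<one> \<in> H"
  using subgroup.one_closed Q subgroups by metis+

text \<open>Rearranging gives \<open>inv n' \<otimes> n = q' \<otimes> inv q\<close>, an element of
  both factors, which meet trivially.\<close>

lemma decomposition_unique:
  assumes "n \<in> N" "n' \<in> N" "q \<in> Q" "q' \<in> Q" and eq: "n \<otimes> q = n' \<otimes> q'"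
  shows "n = n'" and "q = q'"
proof -
  have "inv n' \<otimes> n = q' \<otimes> inv q"
  proof -
    have "inv n' \<otimes> n = inv n' \<otimes> (n \<otimes> q) \<otimes> inv q" using assms(1-4) by (simp add: m_assoc)
    also have "\<dots> = q' \<otimes> inv q" unfolding eq using assms(1-4) by (simp add: m_assoc inv_mult_cancel)
    finally show ?thesis .
  qed
  moreover have "inv n' \<otimes> n \<in> N" "q' \<otimes> inv q \<in> Q"
    using assms(1-4) subgroups(1) Q by (simp_all add: subgroup.m_closed subgroup.m_inv_closed)
  ultimately have "inv n' \<otimes> n = \<one>" "q' \<otimes> inv q = \<one>" using NQ(1) by auto
  then show "n = n'" "q = q'"
    using assms(1-4) by (simp_all add: inv_solve_left' inv_solve_right')
qed

text \<open>The components of \<open>m \<otimes> r\<close> in \<open>N\<close> and \<open>Q\<close>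
  are \<open>m\<close> and \<open>r\<close>, by uniqueness. With one factor trivial this gives
  \<open>M = N \<inter> H\<close> and \<open>R = Q \<inter> H\<close>.\<close>

lemma mult_mem_H_iff:
  assumes "n \<in> N" "q \<in> Q"
  shows "n \<otimes> q \<in> H \<longleftrightarrow> n \<in> M \<and> q \<in> R"
proof
  assume "n \<otimes> q \<in> H"
  then obtain m r where "m \<in> M" "r \<in> R" "n \<otimes> q = m \<otimes> r" unfolding H set_mult_def by blast
  moreover from this have "m \<in> N" "r \<in> Q" using subsets by auto
  ultimately show "n \<in> M \<and> q \<in> R" using decomposition_unique[OF assms(1) _ assms(2)] by metis
qed (auto simp: H set_mult_def)

lemma N_mem_H_iff: "n \<in> N \<Longrightarrow> n \<in> H \<longleftrightarrow> n \<in> M"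
  using mult_mem_H_iff[of n \<one>] by simp

lemma Q_mem_H_iff: "q \<in> Q \<Longrightarrow> q \<in> H \<longleftrightarrow> q \<in> R"
  using mult_mem_H_iff[of \<one> q] by simp

lemma conj_by_N: "x \<in> carrier G \<Longrightarrow> n \<in> N \<Longrightarrow> conj_by x n \<in> N"
  using N by (simp add: conj_by_def normal.inv_op_closed1)

lemma conj_by_M:
  assumes "n \<in> N" "m \<in> M"
  shows "conj_by n m \<in> M"
  using normal.inv_op_closed1[OF M, of n m] assms
  by (simp add: conj_by_def m_inv_consistent[OF subgroups(1)])

lemma conj_by_R_M_iff: "r \<in> R \<Longrightarrow> a \<in> carrier G \<Longrightarrow> conj_by r a \<in> M \<longleftrightarrow> a \<in> M"
  using mem_conjugate_iff_conj_by[of r M a] R_normalizes_M[of r] subgroup.subset[OF subgroups(2)]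
  by auto

section \<open>Finiteness modulo \<open>H\<close>\<close>

definition coverable :: "'a set \<Rightarrow> bool" where
  "coverable S \<longleftrightarrow> (\<exists>Z. finite Z \<and> Z \<subseteq> carrier G \<and> S \<subseteq> (\<Union>z\<in>Z. z <#\<^bsub>G\<^esub> H))"

text \<open>Inheritance by subsets is the reason that \<open>coverable\<close> asks for an
  inclusion; exact unions of cosets are recovered by
  \<open>coverable_eq_Union_cosets\<close>.\<close>

lemma coverable_mono: "coverable S \<Longrightarrow> S' \<subseteq> S \<Longrightarrow> coverable S'"
  unfolding coverable_def by (meson subset_trans)

lemma coverable_Union:
  assumes "finite J" and "\<And>j. j \<in> J \<Longrightarrow> coverable (S j)"
  shows "coverable (\<Union>j\<in>J. S j)"
proof -
  obtain Z where "\<And>j. j \<in> J \<Longrightarrow>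
      finite (Z j) \<and> Z j \<subseteq> carrier G \<and> S j \<subseteq> (\<Union>z\<in>Z j. z <#\<^bsub>G\<^esub> H)"
    using assms(2) unfolding coverable_def by metis
  then show ?thesis
    unfolding coverable_def using assms(1) by (intro exI[of _ "\<Union>j\<in>J. Z j"]) fastforce
qed

lemma coverable_l_coset_H: "x \<in> carrier G \<Longrightarrow> coverable (x <#\<^bsub>G\<^esub> H)"
  unfolding coverable_def by (intro exI[of _ "{x}"]) auto

lemma H_subset: "H \<subseteq> carrier G"
  by auto

lemma coverable_finite:
  assumes "finite S" "S \<subseteq> carrier G"
  shows "coverable S"
proof -
  have "x \<in> x <#\<^bsub>G\<^esub> H" if "x \<in> S" for x
    using that assms(2) by (auto simp: mem_l_coset_iff[OF H_subset])
  then show ?thesis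
    unfolding coverable_def using assms by (intro exI[of _ S]) auto
qed

lemma coverable_l_coset:
  assumes "coverable S" and x: "x \<in> carrier G"
  shows "coverable (x <#\<^bsub>G\<^esub> S)"
proof -
  obtain Z where Z: "finite Z" "Z \<subseteq> carrier G" "S \<subseteq> (\<Union>z\<in>Z. z <#\<^bsub>G\<^esub> H)"
    using assms(1) unfolding coverable_def by blast
  have "x <#\<^bsub>G\<^esub> S \<subseteq> (\<Union>z\<in>Z. (x \<otimes> z) <#\<^bsub>G\<^esub> H)"
  proof
    fix a assume "a \<in> x <#\<^bsub>G\<^esub> S"
    then obtain s where s: "s \<in> S" "a = x \<otimes> s" by (auto simp: l_coset_def)
    then obtain z h where "z \<in> Z" "h \<in> H" "s = z \<otimes> h" using Z(3) unfolding l_coset_def by blast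
    moreover from this have "a = x \<otimes> z \<otimes> h" using s Z(2) x by (auto simp: m_assoc)
    ultimately show "a \<in> (\<Union>z\<in>Z. (x \<otimes> z) <#\<^bsub>G\<^esub> H)" unfolding l_coset_def by blast
  qed
  then show ?thesis
    by (rule coverable_mono[OF coverable_Union[OF Z(1) coverable_l_coset_H], rotated])
      (use Z(2) x in auto)
qed

text \<open>The Hecke condition enters here: each \<open>H z H\<close> is a finite union of left
  cosets.\<close>

lemma coverable_H_mult:
  assumes "coverable S"
  shows "coverable (H <#> S)"
proof -
  obtain Z where Z: "finite Z" "Z \<subseteq> carrier G" "S \<subseteq> (\<Union>z\<in>Z. z <#\<^bsub>G\<^esub> H)"
    using assms unfolding coverable_def by blast
  have "H <#> S \<subseteq> (\<Union>z\<in>Z. H <#> (z <#\<^bsub>G\<^esub> H))"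
  proof
    fix a assume "a \<in> H <#> S"
    then obtain h s where hs: "h \<in> H" "s \<in> S" "a = h \<otimes> s" by (auto simp: set_mult_def)
    moreover from this obtain z where "z \<in> Z" "s \<in> z <#\<^bsub>G\<^esub> H" using Z(3) by blast
    ultimately show "a \<in> (\<Union>z\<in>Z. H <#> (z <#\<^bsub>G\<^esub> H))" by (auto intro: set_mult_memI)
  qed
  moreover have "coverable (H <#> (z <#\<^bsub>G\<^esub> H))" if "z \<in> Z" for z
    using hecke that Z(2) unfolding hecke_pair_def coverable_def by (metis order_refl subsetD)
  ultimately show ?thesis using coverable_mono coverable_Union[OF Z(1)] by meson
qed

text \<open>Choose a representative \<open>w z\<close> inside \<open>S\<close> for every coset
  \<open>z H\<close> that meets \<open>S\<close>. Any other \<open>s\<close> of \<open>S\<close> in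
  that coset satisfies \<open>inv (w z) \<otimes> s \<in> A \<inter> H\<close>. With
  \<open>Q\<close> and \<open>N\<close> for \<open>A\<close> this produces unions of cosets of
  \<open>R\<close> and of \<open>M\<close>.\<close>

lemma coverable_eq_Union_cosets:
  assumes A: "subgroup A G" and "coverable S" and SA: "S \<subseteq> A"
  obtains X where "finite X" "X \<subseteq> A" "S <#> (A \<inter> H) = (\<Union>x\<in>X. x <#\<^bsub>G\<^esub> (A \<inter> H))"
proof -
  obtain Z where Z: "finite Z" "Z \<subseteq> carrier G" "S \<subseteq> (\<Union>z\<in>Z. z <#\<^bsub>G\<^esub> H)"
    using assms(2) unfolding coverable_def by blast
  let ?Z = "{z \<in> Z. S \<inter> (z <#\<^bsub>G\<^esub> H) \<noteq> {}}"
  have "\<forall>z\<in>?Z. \<exists>s. s \<in> S \<inter> (z <#\<^bsub>G\<^esub> H)" by blast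
  then obtain w where w: "\<And>z. z \<in> ?Z \<Longrightarrow> w z \<in> S \<inter> (z <#\<^bsub>G\<^esub> H)" by metis
  have Ac: "a \<in> A \<Longrightarrow> a \<in> carrier G" for a using subgroup.mem_carrier[OF A] .
  have "S <#> (A \<inter> H) \<subseteq> (\<Union>x\<in>w ` ?Z. x <#\<^bsub>G\<^esub> (A \<inter> H))"
  proof
    fix a assume "a \<in> S <#> (A \<inter> H)"
    then obtain s b where s: "s \<in> S" "b \<in> A" "b \<in> H" "a = s \<otimes> b" by (auto simp: set_mult_def)
    then obtain z where z: "z \<in> Z" "s \<in> z <#\<^bsub>G\<^esub> H" using Z(3) by blast
    then have zZ: "z \<in> ?Z" and zc: "z \<in> carrier G" using s Z(2) by auto
    have ws: "w z \<in> S" "inv z \<otimes> w z \<in> H" "inv z \<otimes> s \<in> H"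
      using w[OF zZ] z(2) zc by (auto simp: mem_l_coset_iff[OF H_subset])
    then have c: "s \<in> A" "w z \<in> A" using s(1) SA by auto
    have "inv (inv z \<otimes> w z) \<otimes> (inv z \<otimes> s) \<otimes> b \<in> H"
      using ws s subgroups(4) by (simp add: subgroup.m_closed subgroup.m_inv_closed)
    moreover have "inv (inv z \<otimes> w z) \<otimes> (inv z \<otimes> s) \<otimes> b = inv (w z) \<otimes> a"
      using c zc s by (simp add: Ac inv_mult_group m_assoc inv_mult_cancel)
    moreover have "inv (w z) \<otimes> a \<in> A"
      using c s A by (simp add: subgroup.m_closed subgroup.m_inv_closed)
    ultimately have "a \<in> w z <#\<^bsub>G\<^esub> (A \<inter> H)"
      using c s by (subst mem_l_coset_iff) (auto simp: Ac)
    then show "a \<in> (\<Union>x\<in>w ` ?Z. x <#\<^bsub>G\<^esub> (A \<inter> H))" using zZ by blast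
  qed
  moreover have "w z <#\<^bsub>G\<^esub> (A \<inter> H) \<subseteq> S <#> (A \<inter> H)" if "z \<in> ?Z" for z
    using w[OF that] by (auto simp: l_coset_def set_mult_memI)
  then have "(\<Union>x\<in>w ` ?Z. x <#\<^bsub>G\<^esub> (A \<inter> H)) \<subseteq> S <#> (A \<inter> H)" by blast
  moreover have "finite (w ` ?Z)" "w ` ?Z \<subseteq> A" using Z(1) w SA by auto
  ultimately show ?thesis by (intro that[of "w ` ?Z"] equalityI)
qed

text \<open>For \<open>x = z \<otimes> h\<close> with \<open>h \<in> H\<close>, conjugation by
  \<open>h\<close> preserves \<open>H\<close>, so the condition at \<open>x\<close> follows from
  that at \<open>z\<close>, and finitely many \<open>z\<close> suffice.\<close>

lemma coverable_imp_open:
  assumes "coverable S"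
  obtains U where "openin (hecke_topology G H) U" "\<one> \<in> U"
    "\<forall>a\<in>U. a \<in> carrier G \<and> (\<forall>x\<in>S. conj_by x a \<in> H)"
proof -
  obtain Z where Z: "finite Z" "Z \<subseteq> carrier G" "S \<subseteq> (\<Union>z\<in>Z. z <#\<^bsub>G\<^esub> H)"
    using assms unfolding coverable_def by blast
  \<comment> \<open>Adding \<open>\<one>\<close> keeps the intersection inside
    \<open>carrier G\<close> even when \<open>Z\<close> is empty.\<close>
  let ?U = "\<Inter>z\<in>insert \<one> Z. conjugate G z H"
  have *: "openin (hecke_topology G H) (conjugate G z H) \<and> \<one> \<in> conjugate G z H"
    if "z \<in> insert \<one> Z" for z
    using that Z(2) hecke_topology_local_subbase(1)[OF subgroups(4)] by auto
  have "openin (hecke_topology G H) ?U"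
    using * Z(1) by (intro openin_INT2) auto
  moreover have "\<one> \<in> ?U" using * by blast
  moreover have "a \<in> carrier G \<and> (\<forall>x\<in>S. conj_by x a \<in> H)" if a: "a \<in> ?U" for a
  proof (intro conjI ballI)
    show ac: "a \<in> carrier G" using a H_subset by (simp add: mem_conjugate_iff)
    fix x assume "x \<in> S"
    then obtain z h where zh: "z \<in> Z" "h \<in> H" "x = z \<otimes> h" using Z(3) unfolding l_coset_def by blast
    then have zc: "z \<in> carrier G" using Z(2) by blast
    have "a \<in> conjugate G z H" using a zh(1) by blast
    then have "conj_by z a \<in> H"
      using zc by (simp add: mem_conjugate_iff_conj_by[OF _ H_subset])
    then show "conj_by x a \<in> H"
      using zh zc ac conj_by_subgroup[OF subgroups(4)] by (simp add: conj_by_comp)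
  qed
  ultimately show ?thesis by (rule that[OF _ _ ballI])
qed

section \<open>The index families: finiteness, existence, directedness\<close>

abbreviation "\<E> \<equiv> E_family G Q R"
abbreviation "\<F> \<equiv> EF_family G N Q M R"

lemma \<E>_D:
  assumes "E \<in> \<E>"
  shows "E \<subseteq> Q" "\<one> \<in> E" "r \<in> R \<Longrightarrow> q \<in> E \<Longrightarrow> r \<otimes> q \<in> E" "coverable E"
proof -
  show "E \<subseteq> Q" "\<one> \<in> E" using assms by (auto simp: E_family_def)
  have "R <#> E = E" using assms by (auto simp: E_family_def)
  then show "r \<in> R \<Longrightarrow> q \<in> E \<Longrightarrow> r \<otimes> q \<in> E" unfolding set_mult_def by blast
  obtain X where X: "finite X" "X \<subseteq> Q" "E = (\<Union>x\<in>X. x <#\<^bsub>G\<^esub> R)"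
    using assms by (auto simp: E_family_def)
  have "E \<subseteq> (\<Union>x\<in>X. x <#\<^bsub>G\<^esub> H)" using X(3) subsets(4) unfolding l_coset_def by blast
  then show "coverable E"
    by (rule coverable_mono[OF coverable_Union[OF X(1) coverable_l_coset_H], rotated])
      (use X(2) in auto)
qed

text \<open>For the last claim, an element of \<open>E <#> F\<close> has the form
  \<open>x r y m\<close> with \<open>x\<close>, \<open>y\<close> from finite sets. The factor
  \<open>r\<close> in the middle forces a passage through \<open>H y H\<close>, where finiteness
  comes from the Hecke condition.\<close>

lemma \<F>_D:
  assumes "(E, F) \<in> \<F>"
  shows "E \<in> \<E>" "F \<subseteq> N" "q \<in> E \<Longrightarrow> m \<in> M \<Longrightarrow> conj_by q m \<in> F" "\<one> \<in> F" "coverable (E <#> F)"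
proof -
  show E: "E \<in> \<E>" and F: "F \<subseteq> N" using assms by (auto simp: EF_family_def)
  show conj: "conj_by q m \<in> F" if "q \<in> E" "m \<in> M" for q m
  proof -
    have "q \<in> Q" using \<E>_D(1)[OF E] that by blast
    then have "conj_by q m \<in> conjugate G (inv q) M"
      using that subgroup.subset[OF subgroups(2)] by (simp add: mem_conjugate_iff_conj_by conj_by_cancel)
    then show ?thesis using that assms by (auto simp: EF_family_def)
  qed
  show "\<one> \<in> F" using conj[OF \<E>_D(2)[OF E], of \<one>] by simp
  obtain X where X: "finite X" "X \<subseteq> Q" "E = (\<Union>x\<in>X. x <#\<^bsub>G\<^esub> R)"
    using E by (auto simp: E_family_def)
  obtain Y where Y: "finite Y" "Y \<subseteq> N" "F = (\<Union>y\<in>Y. y <#\<^bsub>G\<^esub> M)"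
    using assms by (auto simp: EF_family_def)
  have "E <#> F \<subseteq> (\<Union>x\<in>X. x <#\<^bsub>G\<^esub> (H <#> (\<Union>y\<in>Y. y <#\<^bsub>G\<^esub> H)))"
  proof
    fix a assume "a \<in> E <#> F"
    then obtain x r y m where *: "x \<in> X" "r \<in> R" "y \<in> Y" "m \<in> M" "a = x \<otimes> r \<otimes> (y \<otimes> m)"
      unfolding X(3) Y(3) set_mult_def l_coset_def by blast
    then have c: "x \<in> carrier G" "y \<in> carrier G" using X Y by auto
    then have "a = x \<otimes> (r \<otimes> (y \<otimes> m))" using * by (simp add: m_assoc)
    moreover have "r \<in> H" "m \<in> H" using * subsets by auto
    then have "y \<otimes> m \<in> (\<Union>y\<in>Y. y <#\<^bsub>G\<^esub> H)" using *(3) l_coset_memI by blast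
    then have "x \<otimes> (r \<otimes> (y \<otimes> m)) \<in> x <#\<^bsub>G\<^esub> (H <#> (\<Union>y\<in>Y. y <#\<^bsub>G\<^esub> H))"
      using \<open>r \<in> H\<close> by (intro l_coset_memI set_mult_memI)
    ultimately show "a \<in> (\<Union>x\<in>X. x <#\<^bsub>G\<^esub> (H <#> (\<Union>y\<in>Y. y <#\<^bsub>G\<^esub> H)))"
      using *(1) by blast
  qed
  moreover have "coverable (\<Union>x\<in>X. x <#\<^bsub>G\<^esub> (H <#> (\<Union>y\<in>Y. y <#\<^bsub>G\<^esub> H)))"
    using X Y by (intro coverable_Union coverable_l_coset coverable_H_mult coverable_l_coset_H) auto
  ultimately show "coverable (E <#> F)" by (rule coverable_mono[rotated])
qed

lemma R_eq: "R = Q \<inter> H" and M_eq: "M = N \<inter> H"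
  using Q_mem_H_iff N_mem_H_iff subsets by auto

text \<open>The witness is \<open>R Y R\<close>, with \<open>\<one>\<close> added to
  \<open>Y\<close>. It is invariant under \<open>R\<close> on the left because
  \<open>R R = R\<close>, and it is a finite union of left cosets because \<open>R Y\<close> lies in
  \<open>H Y\<close>.\<close>

lemma ex_\<E>:
  assumes Y: "finite Y" "Y \<subseteq> Q"
  obtains E where "E \<in> \<E>" "Y \<subseteq> E"
proof -
  let ?Y = "insert \<one> Y"
  let ?S = "R <#> ?Y"
  have c: "R \<subseteq> carrier G" "?Y \<subseteq> carrier G" "?S \<subseteq> carrier G"
    using Y subsets by (auto simp: set_mult_def)
  have S: "?S \<subseteq> Q" using Y(2) subsets(2) subgroup.m_closed[OF Q] by (auto simp: set_mult_def)
  have "coverable (H <#> ?Y)"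
    using Y c by (intro coverable_H_mult coverable_finite) auto
  then have "coverable ?S"
    by (rule coverable_mono) (use subsets(4) in \<open>auto simp: set_mult_def\<close>)
  from coverable_eq_Union_cosets[OF Q this S]
  obtain X where X: "finite X" "X \<subseteq> Q" "?S <#> R = (\<Union>x\<in>X. x <#\<^bsub>G\<^esub> R)"
    by (metis R_eq)
  have RR: "R <#> R = R" using subgroup_mult_id[OF subgroups(3)] .
  have "R <#> (?S <#> R) = ?S <#> R"
    by (simp only: RR flip: set_mult_assoc[OF c(1,3,1)] set_mult_assoc[OF c(1,1,2)])
  moreover have "?S <#> R \<subseteq> Q" 
    using S subsets(2) subgroup.m_closed[OF Q] by (auto simp: set_mult_def)
  moreover have in_SR: "y \<in> ?S <#> R" if "y \<in> ?Y" for y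
  proof -
    have "y = \<one> \<otimes> y \<otimes> \<one>" using that c by auto
    then show ?thesis using that ones(4) unfolding set_mult_def by blast
  qed
  ultimately have "?S <#> R \<in> \<E>" using X unfolding E_family_def by blast
  then show ?thesis using that in_SR by blast
qed

text \<open>\<open>E\<close> may be infinite, but for \<open>q = x \<otimes> r\<close> the conjugate
  \<open>q^-1 M q\<close> lies in \<open>H x^-1 H x H\<close>, which depends only on
  \<open>x\<close>. With finitely many \<open>x\<close>, all the required conjugates together are
  coverable, and multiplying by \<open>M\<close> on the right turns them into cosets.\<close>

lemma ex_\<F>:
  assumes E: "E \<in> \<E>" and Y: "finite Y" "Y \<subseteq> N"
  obtains F where "(E, F) \<in> \<F>" "Y \<subseteq> F"
proof -
  let ?S = "Y \<union> (\<Union>q\<in>E. conjugate G (inv q) M)"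
  have Mc: "M \<subseteq> carrier G" by auto
  have mem: "a \<in> conjugate G (inv q) M \<longleftrightarrow> (\<exists>m\<in>M. a = conj_by q m)" if "q \<in> E" for q a
  proof -
    have q: "q \<in> carrier G" using that \<E>_D(1)[OF E] by auto
    then have "a \<in> conjugate G (inv q) M \<longleftrightarrow> a \<in> carrier G \<and> conj_by (inv q) a \<in> M"
      by (simp add: mem_conjugate_iff_conj_by[OF _ Mc])
    also have "\<dots> \<longleftrightarrow> (\<exists>m\<in>M. a = conj_by q m)"
      using q by (metis carriers(3) conj_by_cancel conj_by_closed)
    finally show ?thesis .
  qed
  have "conj_by q m \<in> N" if "q \<in> E" "m \<in> M" for q m
    using that \<E>_D(1)[OF E] subsets(1) by (intro conj_by_N) auto
  then have S: "?S \<subseteq> N"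
    using Y(2) mem by auto
  obtain X where X: "finite X" "X \<subseteq> Q" "E = (\<Union>x\<in>X. x <#\<^bsub>G\<^esub> R)"
    using E by (auto simp: E_family_def)
  let ?C = "\<Union>x\<in>X. H <#> (inv x <#\<^bsub>G\<^esub> (H <#> (x <#\<^bsub>G\<^esub> H)))"
  have "coverable (Y \<union> ?C)"
  proof -
    have "coverable Y" "coverable ?C"
      using X Y by (auto intro!: coverable_finite coverable_Union coverable_H_mult coverable_l_coset
          coverable_l_coset_H)
    then show ?thesis
      using coverable_Union[of UNIV "\<lambda>b. if b then Y else ?C"]
      by (simp add: UNIV_bool Un_commute)
  qed
  moreover have "conjugate G (inv q) M \<subseteq> ?C" if q: "q \<in> E" for q
  proof
    fix a assume "a \<in> conjugate G (inv q) M"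
    then obtain m where m: "m \<in> M" "a = conj_by q m" using mem[OF q] by blast
    obtain x r where x: "x \<in> X" "r \<in> R" "q = x \<otimes> r" using q X(3) unfolding l_coset_def by blast
    have xc: "x \<in> carrier G" using x X by auto
    have "a = inv r \<otimes> (inv x \<otimes> (m \<otimes> (x \<otimes> r)))"
      using m x xc by (simp add: conj_by_def inv_mult_group m_assoc)
    moreover have "inv r \<in> H" "m \<in> H" "r \<in> H"
      using x m subsets subgroup.m_inv_closed[OF subgroups(4)] by auto
    ultimately have "a \<in> H <#> (inv x <#\<^bsub>G\<^esub> (H <#> (x <#\<^bsub>G\<^esub> H)))"
      by (simp only: l_coset_memI set_mult_memI)
    then show "a \<in> ?C" using x(1) by blast
  qed
  ultimately have "coverable ?S" by (elim coverable_mono) blast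
  from coverable_eq_Union_cosets[OF subgroups(1) this S]
  obtain Z where Z: "finite Z" "Z \<subseteq> N" "?S <#> M = (\<Union>x\<in>Z. x <#\<^bsub>G\<^esub> M)"
    by (metis M_eq)
  have in_SM: "?S \<subseteq> ?S <#> M"
  proof
    fix s assume s: "s \<in> ?S"
    then have "s = s \<otimes> \<one>" using S by (metis carriers(1) r_one subsetD)
    then show "s \<in> ?S <#> M" using s ones(3) unfolding set_mult_def by blast
  qed
  have "?S <#> M \<subseteq> N"
    using mono_set_mult[OF S subsets(1), of G] subgroup_mult_id[OF subgroups(1)]
    by simp
  moreover have "\<forall>q\<in>E. conjugate G (inv q) M \<subseteq> ?S <#> M" using in_SM by blast
  ultimately have "(E, ?S <#> M) \<in> \<F>"
    using Z E unfolding EF_family_def by blast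
  then show ?thesis using that in_SM by blast
qed

lemma \<E>_directed:
  assumes "E \<in> \<E>" "E' \<in> \<E>"
  shows "E \<union> E' \<in> \<E>"
proof -
  obtain X X' where "finite X" "X \<subseteq> Q" "E = (\<Union>x\<in>X. x <#\<^bsub>G\<^esub> R)"
    "finite X'" "X' \<subseteq> Q" "E' = (\<Union>x\<in>X'. x <#\<^bsub>G\<^esub> R)"
    using assms unfolding E_family_def by blast
  then have "finite (X \<union> X')" "X \<union> X' \<subseteq> Q" "E \<union> E' = (\<Union>x\<in>X \<union> X'. x <#\<^bsub>G\<^esub> R)" by auto
  moreover have "R <#> (E \<union> E') = (R <#> E) \<union> (R <#> E')" by (auto simp: set_mult_def)
  moreover have "E \<subseteq> Q" "E' \<subseteq> Q" "\<one> \<in> E" "R <#> E = E" "R <#> E' = E'"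
    using assms by (simp_all add: E_family_def)
  ultimately show ?thesis
    unfolding E_family_def by (intro CollectI conjI exI[of _ "X \<union> X'"]) auto
qed

lemma \<F>_directed:
  assumes "(E, F) \<in> \<F>" "(E', F') \<in> \<F>"
  shows "(E \<union> E', F \<union> F') \<in> \<F>"
proof -
  obtain X X' where "finite X" "X \<subseteq> N" "F = (\<Union>x\<in>X. x <#\<^bsub>G\<^esub> M)"
    "finite X'" "X' \<subseteq> N" "F' = (\<Union>x\<in>X'. x <#\<^bsub>G\<^esub> M)"
    using assms unfolding EF_family_def by blast
  then have "finite (X \<union> X')" "X \<union> X' \<subseteq> N" "F \<union> F' = (\<Union>x\<in>X \<union> X'. x <#\<^bsub>G\<^esub> M)" by auto
  moreover have "E \<union> E' \<in> \<E>" using \<E>_directed assms \<F>_D(1) by blast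
  moreover have "F \<union> F' \<subseteq> N" "\<forall>q\<in>E \<union> E'. conjugate G (inv q) M \<subseteq> F \<union> F'"
    using assms by (auto simp: EF_family_def)
  ultimately show ?thesis
    unfolding EF_family_def mem_Collect_eq case_prod_conv
    by (intro conjI exI[of _ "X \<union> X'"])
qed

section \<open>The subgroups expressed through conjugates of \<open>M\<close> and
  \<open>H\<close>\<close>

lemma M_sub_eq:
  assumes "E \<in> \<E>"
  shows "M_sub G M E = {a \<in> M. \<forall>q\<in>E. conj_by q a \<in> M}"
proof -
  have "a \<in> conjugate G q M \<longleftrightarrow> a \<in> carrier G \<and> conj_by q a \<in> M" if "q \<in> E" for q a
    using that \<E>_D(1)[OF assms] by (intro mem_conjugate_iff_conj_by) auto
  then show ?thesis
    using \<E>_D(2)[OF assms] by (auto simp: M_sub_def)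
qed

text \<open>For \<open>k = n^-1 (r^-1 n r)\<close> the inverse of \<open>conj_by n r\<close> is
  \<open>k r^-1\<close>, so \<open>conj_by n r\<close> lies in \<open>H\<close> exactly when
  \<open>k\<close> lies in \<open>M\<close>. As \<open>R\<close> normalizes \<open>M\<close>, this
  is exactly the condition that conjugation by \<open>r\<close> fixes the coset of
  \<open>n\<close>.\<close>

lemma R_stab_eq:
  assumes n: "n \<in> N"
  shows "R_stab G M R n = {r \<in> R. conj_by n r \<in> H}"
proof -
  have Mc: "M \<subseteq> carrier G" by auto
  have "conjugate G r (n <#\<^bsub>G\<^esub> M) = n <#\<^bsub>G\<^esub> M \<longleftrightarrow> conj_by n r \<in> H" if r: "r \<in> R" for r
  proof -
    define k where "k = inv n \<otimes> conj_by r n"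
    have kN: "k \<in> N"
      using n r conj_by_N subgroups(1) by (simp add: k_def subgroup.m_closed subgroup.m_inv_closed)
    have "inv (conj_by n r) = k \<otimes> inv r"
      using n r by (simp add: k_def conj_by_def m_assoc inv_mult_group)
    then have "inv (conj_by n r) \<in> H \<longleftrightarrow> k \<in> M \<and> inv r \<in> R"
      using mult_mem_H_iff[of k "inv r"] kN r subsets(2) Q by (simp add: subgroup.m_inv_closed subset_iff)
    moreover have "inv (conj_by n r) \<in> H \<longleftrightarrow> conj_by n r \<in> H"
      using n r by (simp add: subgroup_inv_mem_iff[OF subgroups(4)])
    moreover have "inv r \<in> R" using r subgroups(3) by (simp add: subgroup_inv_mem_iff)
    ultimately have k: "conj_by n r \<in> H \<longleftrightarrow> k \<in> M" by blast
    have nM: "n <#\<^bsub>G\<^esub> M \<subseteq> carrier G" using n by (intro l_coset_subset_G) auto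
    have mem: "a \<in> conjugate G r (n <#\<^bsub>G\<^esub> M) \<longleftrightarrow> a \<in> carrier G \<and> inv n \<otimes> conj_by r a \<in> M" for a
      using n r by (auto simp: mem_conjugate_iff_conj_by[OF _ nM] mem_l_coset_iff[OF Mc])
    show ?thesis
    proof
      assume "conjugate G r (n <#\<^bsub>G\<^esub> M) = n <#\<^bsub>G\<^esub> M"
      moreover have "n \<in> n <#\<^bsub>G\<^esub> M" using n by (simp add: mem_l_coset_iff[OF Mc])
      ultimately have "k \<in> M" using mem[of n] by (simp add: k_def)
      then show "conj_by n r \<in> H" using k by blast
    next
      assume "conj_by n r \<in> H"
      then have kM: "k \<in> M" using k by blast
      have "inv n \<otimes> conj_by r a \<in> M \<longleftrightarrow> inv n \<otimes> a \<in> M" if a: "a \<in> carrier G" for a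
      proof -
        have eq: "inv n \<otimes> conj_by r a = k \<otimes> conj_by r (inv n \<otimes> a)"
          using n r a by (simp add: k_def conj_by_def m_assoc inv_mult_cancel)
        have "k \<otimes> conj_by r (inv n \<otimes> a) \<in> M \<longleftrightarrow> conj_by r (inv n \<otimes> a) \<in> M"
        proof
          assume "k \<otimes> conj_by r (inv n \<otimes> a) \<in> M"
          then have "inv k \<otimes> (k \<otimes> conj_by r (inv n \<otimes> a)) \<in> M"
            using kM subgroups(2) by (simp only: subgroup.m_closed subgroup.m_inv_closed)
          then show "conj_by r (inv n \<otimes> a) \<in> M"
            using kM n r a by (simp add: inv_mult_cancel)
        qed (use kM subgroup.m_closed[OF subgroups(2)] in blast)
        then show ?thesis using conj_by_R_M_iff[OF r, of "inv n \<otimes> a"] n a by (simp add: eq)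
      qed
      then show "conjugate G r (n <#\<^bsub>G\<^esub> M) = n <#\<^bsub>G\<^esub> M"
        using n by (auto simp: mem mem_l_coset_iff[OF Mc])
    qed
  qed
  then show ?thesis by (auto simp: R_stab_def)
qed

lemma R_sub_eq:
  assumes EF: "(E, F) \<in> \<F>"
  shows "R_sub G M R (E, F) = {r \<in> R. \<forall>x\<in>E <#> F. conj_by x r \<in> H}"
proof -
  note E = \<F>_D(1)[OF EF]
  have R_F: "(\<Inter>n\<in>F. R_stab G M R n) = {r \<in> R. \<forall>n\<in>F. conj_by n r \<in> H}"
    using R_stab_eq \<F>_D(2,4)[OF EF] by blast
  have conj: "r \<in> conjugate G q (\<Inter>n\<in>F. R_stab G M R n) \<longleftrightarrow> (\<forall>n\<in>F. conj_by (q \<otimes> n) r \<in> H)"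
    if q: "q \<in> E" and r: "r \<in> R" for q r
  proof -
    have qQ: "q \<in> Q" using q \<E>_D(1)[OF E] by blast
    have comp: "conj_by (q \<otimes> n) r = conj_by n (conj_by q r)" if "n \<in> F" for n
      using that \<F>_D(2)[OF EF] qQ r by (auto simp: conj_by_comp)
    \<comment> \<open>Stabilizers consist of elements of \<open>R\<close>, so this membership is
      needed first; the case \<open>n = \<one>\<close>, available because
      \<open>\<one> \<in> F\<close>, gives it by \<open>Q \<inter> H = R\<close>.\<close>
    have "conj_by q r \<in> R" if "\<forall>n\<in>F. conj_by (q \<otimes> n) r \<in> H"
    proof -
      have "conj_by q r \<in> H" using that \<F>_D(4)[OF EF] comp[of \<one>] qQ r by fastforce
      moreover have "conj_by q r \<in> Q" using qQ r subsets(2) conj_by_subgroup[OF Q] by blast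
      ultimately show ?thesis using Q_mem_H_iff by blast
    qed
    moreover have "{r \<in> R. \<forall>n\<in>F. conj_by n r \<in> H} \<subseteq> carrier G" by auto
    ultimately show ?thesis
      using qQ r comp by (auto simp: R_F mem_conjugate_iff_conj_by)
  qed
  have "r \<in> R_sub G M R (E, F) \<longleftrightarrow> r \<in> R \<and> (\<forall>q\<in>E. \<forall>n\<in>F. conj_by (q \<otimes> n) r \<in> H)" for r
    using conj by (auto simp: R_sub_def)
  then show ?thesis by (auto simp: set_mult_def)
qed

lemma EF_subset: "(E, F) \<in> \<F> \<Longrightarrow> E <#> F \<subseteq> carrier G"
  using \<F>_D(1,2) \<E>_D(1) by (fastforce simp: set_mult_def)

lemma subgroup_M_sub: "E \<in> \<E> \<Longrightarrow> subgroup (M_sub G M E) G"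
  using subgroup_conj_by_mem[OF subgroups(2,2), of E] \<E>_D(1)[of E] subgroup.subset[OF Q]
  by (simp add: M_sub_eq)

lemma subgroup_R_sub: "(E, F) \<in> \<F> \<Longrightarrow> subgroup (R_sub G M R (E, F)) G"
  using subgroup_conj_by_mem[OF subgroups(3,4)] EF_subset by (simp add: R_sub_eq)

text \<open>Interchange the conjugations: \<open>conj_by q\<close> sends the conjugate of
  \<open>a\<close> by \<open>n\<close> to the conjugate of \<open>conj_by q a\<close> by
  \<open>conj_by q n\<close>, again an element of \<open>N\<close>, and \<open>M\<close> is normal
  in \<open>N\<close>.\<close>

lemma conj_by_N_M_sub:
  assumes E: "E \<in> \<E>" and n: "n \<in> N" and a: "a \<in> M_sub G M E"
  shows "conj_by n a \<in> M_sub G M E"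
proof -
  have a: "a \<in> M" "\<And>q. q \<in> E \<Longrightarrow> conj_by q a \<in> M" using a by (auto simp: M_sub_eq[OF E])
  have "conj_by q (conj_by n a) \<in> M" if q: "q \<in> E" for q
  proof -
    have qc: "q \<in> carrier G" using q \<E>_D(1)[OF E] by auto
    have "conj_by q (conj_by n a) = conj_by (conj_by q n) (conj_by q a)"
      using qc n a(1) by (simp add: conj_by_def m_assoc inv_mult_group inv_mult_cancel)
    then show ?thesis using conj_by_M[OF conj_by_N[OF qc n] a(2)[OF q]] by simp
  qed
  then show ?thesis using conj_by_M[OF n a(1)] by (simp add: M_sub_eq[OF E])
qed

text \<open>Conjugating by \<open>r\<close> and then by \<open>q\<close> is conjugating by
  \<open>r \<otimes> q\<close>, which stays in \<open>E\<close> since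
  \<open>R E = E\<close>.\<close>

lemma conj_by_R_M_sub:
  assumes E: "E \<in> \<E>" and r: "r \<in> R" and a: "a \<in> M_sub G M E"
  shows "conj_by r a \<in> M_sub G M E"
proof -
  have a: "a \<in> M" "\<And>q. q \<in> E \<Longrightarrow> conj_by q a \<in> M" using a by (auto simp: M_sub_eq[OF E])
  have "conj_by q (conj_by r a) \<in> M" if q: "q \<in> E" for q
    using a(2)[OF \<E>_D(3)[OF E r q]] q \<E>_D(1)[OF E] r a(1) by (auto simp: conj_by_comp)
  then show ?thesis using conj_by_R_M_iff[OF r] a(1) by (simp add: M_sub_eq[OF E])
qed

lemma M_sub_subset: "E \<in> \<E> \<Longrightarrow> M_sub G M E \<subseteq> M"
  by (auto simp: M_sub_eq)

lemma R_sub_subset: "i \<in> \<F> \<Longrightarrow> R_sub G M R i \<subseteq> R"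
  by (cases i) (auto simp: R_sub_eq)

lemma M_sub_normal:
  assumes "E \<in> \<E>"
  shows "M_sub G M E \<lhd> G\<lparr>carrier := N\<rparr>" and "M_sub G M E \<lhd> G\<lparr>carrier := M\<rparr>"
  using assms subgroups subgroup_M_sub M_sub_subset subsets(1) conj_by_N_M_sub
  by (auto intro!: normal_in_subgroupI)

text \<open>Left multiplication by \<open>r\<close> preserves \<open>E <#> F\<close>, so the
  defining conditions of \<open>R_sub\<close> are merely permuted.\<close>

lemma R_sub_normal:
  assumes "i \<in> \<F>"
  shows "R_sub G M R i \<lhd> G\<lparr>carrier := R\<rparr>"
proof (cases i)
  case (Pair E F)
  then have EF: "(E, F) \<in> \<F>" using assms by simp
  note E = \<F>_D(1)[OF EF]
  have "conj_by r s \<in> R_sub G M R (E, F)" if r: "r \<in> R" and "s \<in> R_sub G M R (E, F)" for r s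
  proof -
    have s: "s \<in> R" "\<And>x. x \<in> E <#> F \<Longrightarrow> conj_by x s \<in> H" using that by (auto simp: R_sub_eq[OF EF])
    have "conj_by x (conj_by r s) \<in> H" if EFx: "x \<in> E <#> F" for x
    proof -
      obtain q n where x: "q \<in> E" "n \<in> F" "x = q \<otimes> n" using EFx unfolding set_mult_def by blast
      then have c: "q \<in> carrier G" "n \<in> carrier G" using \<E>_D(1)[OF E] \<F>_D(2)[OF EF] by auto
      have "r \<otimes> x = (r \<otimes> q) \<otimes> n" using x c r by (simp add: m_assoc)
      then have "r \<otimes> x \<in> E <#> F" using \<E>_D(3)[OF E r x(1)] x(2) by (auto simp: set_mult_def)
      then show ?thesis using s r x c by (metis carriers(4) conj_by_comp m_closed)
    qed
    then show ?thesis using conj_by_subgroup[OF subgroups(3) r s(1)] by (simp add: R_sub_eq[OF EF])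
  qed
  then show ?thesis
    using subgroup_R_sub[OF EF] R_sub_subset[OF EF] subgroups(3) Pair
    by (auto intro!: normal_in_subgroupI)
qed

section \<open>Monotonicity and neighbourhood bases\<close>

lemma M_sub_antimono: "E \<subseteq> E' \<Longrightarrow> M_sub G M E' \<subseteq> M_sub G M E"
  by (auto simp: M_sub_def)

lemma R_sub_antimono: "i \<in> \<F> \<Longrightarrow> j \<in> \<F> \<Longrightarrow> i \<le> j \<Longrightarrow> R_sub G M R j \<subseteq> R_sub G M R i"
  by (cases i; cases j) (auto simp: R_sub_eq set_mult_def)

text \<open>Intersecting with \<open>N\<close> rather than \<open>M\<close> serves both limits over
  \<open>\<E>\<close>: conjugates of elements of \<open>N\<close> stay in \<open>N\<close>, and
  \<open>N \<inter> H = M\<close>.\<close>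

lemma M_sub_open:
  assumes E: "E \<in> \<E>"
  shows "\<exists>U. openin (hecke_topology G H) U \<and> \<one> \<in> U \<and> N \<inter> U \<subseteq> M_sub G M E"
proof -
  obtain U where U: "openin (hecke_topology G H) U" "\<one> \<in> U"
    "\<forall>a\<in>U. a \<in> carrier G \<and> (\<forall>x\<in>E. conj_by x a \<in> H)"
    using coverable_imp_open[OF \<E>_D(4)[OF E]] by blast
  have "a \<in> M_sub G M E" if a: "a \<in> N" "a \<in> U" for a
  proof -
    have "conj_by q a \<in> M" if "q \<in> E" for q
    proof -
      have "q \<in> carrier G" using that \<E>_D(1)[OF E] by auto
      moreover have "conj_by q a \<in> H" using U(3) a(2) that by blast
      ultimately show ?thesis using a(1) N_mem_H_iff conj_by_N by blast
    qed
    moreover from this[of \<one>] have "a \<in> M" using \<E>_D(2)[OF E] a by simp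
    ultimately show ?thesis by (simp add: M_sub_eq[OF E])
  qed
  then show ?thesis using U(1,2) by blast
qed

text \<open>One condition on \<open>m \<otimes> r\<close> controls both factors. Since
  \<open>\<one> \<in> F\<close>, each \<open>q\<close> of \<open>E\<close> is itself a conjugator in
  \<open>E <#> F\<close>; there the product splits along \<open>N Q\<close> and yields
  \<open>conj_by q m \<in> M\<close>. For \<open>x = q \<otimes> n\<close> the conjugate of
  \<open>m\<close> is then still in \<open>M\<close> and can be divided out, leaving that of
  \<open>r\<close> in \<open>H\<close>.\<close>

lemma M_sub_R_sub_open:
  assumes EF: "(E, F) \<in> \<F>"
  shows "\<exists>U. openin (hecke_topology G H) U \<and> \<one> \<in> U \<and>
    (\<forall>m\<in>M. \<forall>r\<in>R. m \<otimes> r \<in> U \<longrightarrow> m \<in> M_sub G M E \<and> r \<in> R_sub G M R (E, F))"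
proof -
  note E = \<F>_D(1)[OF EF]
  obtain U where U: "openin (hecke_topology G H) U" "\<one> \<in> U"
    "\<forall>a\<in>U. a \<in> carrier G \<and> (\<forall>x\<in>E <#> F. conj_by x a \<in> H)"
    using coverable_imp_open[OF \<F>_D(5)[OF EF]] by blast
  have "m \<in> M_sub G M E \<and> r \<in> R_sub G M R (E, F)"
    if mr: "m \<in> M" "r \<in> R" "m \<otimes> r \<in> U" for m r
  proof -
    have m: "conj_by q m \<in> M" if q: "q \<in> E" for q
    proof -
      have qQ: "q \<in> Q" using q \<E>_D(1)[OF E] by blast
      have "q \<in> E <#> F" using q qQ \<F>_D(4)[OF EF] unfolding set_mult_def by force
      then have "conj_by q (m \<otimes> r) \<in> H" using U(3) mr(3) by blast
      then have "conj_by q m \<otimes> conj_by q r \<in> H" using qQ mr by (simp add: conj_by_mult)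
      moreover have "conj_by q m \<in> N" "conj_by q r \<in> Q"
        using qQ mr subsets conj_by_N conj_by_subgroup[OF Q] by (auto simp: subset_iff)
      ultimately show ?thesis using mult_mem_H_iff by blast
    qed
    have "conj_by x r \<in> H" if EFx: "x \<in> E <#> F" for x
    proof -
      obtain q n where x: "q \<in> E" "n \<in> F" "x = q \<otimes> n" using EFx unfolding set_mult_def by blast
      then have q: "q \<in> carrier G" and n: "n \<in> N" using \<E>_D(1)[OF E] \<F>_D(2)[OF EF] by auto
      have "conj_by x (m \<otimes> r) \<in> H" using U(3) mr(3) that by blast
      moreover have "conj_by x m \<in> H"
        using m[OF x(1)] conj_by_M[OF n] x(3) q n mr subsets(3) by (auto simp: conj_by_comp)
      ultimately have "inv (conj_by x m) \<otimes> conj_by x (m \<otimes> r) \<in> H"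
        using subgroups(4) by (simp add: subgroup.m_closed subgroup.m_inv_closed)
      then show ?thesis using x q n mr by (simp add: conj_by_mult inv_mult_cancel)
    qed
    then show ?thesis using m mr by (simp add: M_sub_eq[OF E] R_sub_eq[OF EF])
  qed
  then show ?thesis using U(1,2) by blast
qed

lemma M_sub_R_sub_small:
  assumes U: "openin (hecke_topology G H) U" "\<one> \<in> U"
  shows "\<exists>(E, F)\<in>\<F>. M_sub G M E <#> R_sub G M R (E, F) \<subseteq> U"
proof -
  obtain X where X: "finite X" "X \<subseteq> carrier G" "(\<Inter>x\<in>X. conjugate G x H) \<subseteq> U"
    using hecke_topology_local_subbase(2)[OF subgroups(4) U] by blast
  have "\<exists>q n. q \<in> Q \<and> n \<in> N \<and> x = q \<otimes> n" if x: "x \<in> X" for x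
  proof -
    \<comment> \<open>The order \<open>q \<otimes> n\<close> is opposite to that in
      \<open>NQ\<close>; it is obtained by decomposing the inverse.\<close>
    have "inv x \<in> N <#> Q" using x X(2) NQ(2) by auto
    then obtain n q where nq: "n \<in> N" "q \<in> Q" "inv x = n \<otimes> q" by (auto simp: set_mult_def)
    then have "inv (inv x) = inv q \<otimes> inv n" by (simp add: inv_mult_group)
    then have "x = inv q \<otimes> inv n" using x X(2) by (simp add: subset_iff)
    then show ?thesis
      using nq subgroup.m_inv_closed[OF subgroups(1)] subgroup.m_inv_closed[OF Q] by blast
  qed
  then obtain q n where qn: "\<And>x. x \<in> X \<Longrightarrow> q x \<in> Q \<and> n x \<in> N \<and> x = q x \<otimes> n x" by metis
  obtain E where E: "E \<in> \<E>" "q ` X \<subseteq> E" using ex_\<E>[of "q ` X"] X(1) qn by auto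
  obtain F where F: "(E, F) \<in> \<F>" "n ` X \<subseteq> F" using ex_\<F>[OF E(1), of "n ` X"] X(1) qn by auto
  have "a \<otimes> r \<in> U" if a: "a \<in> M_sub G M E" and r: "r \<in> R_sub G M R (E, F)" for a r
  proof -
    have ac: "a \<in> M" "r \<in> R" using a r M_sub_subset[OF E(1)] R_sub_subset[OF F(1)] by auto
    have "a \<otimes> r \<in> conjugate G x H" if x: "x \<in> X" for x
    proof -
      have q: "q x \<in> E" "n x \<in> F" "q x \<in> Q" "n x \<in> N" "x = q x \<otimes> n x" using qn x E F by auto
      then have "x \<in> E <#> F" by (auto simp: set_mult_def)
      then have "conj_by x r \<in> H" using r by (auto simp: R_sub_eq[OF F(1)])
      moreover have "conj_by x a \<in> M"
      proof -
        have "conj_by (q x) a \<in> M" using a q(1) by (simp add: M_sub_eq[OF E(1)])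
        then show ?thesis using conj_by_M[OF q(4)] q(3-5) ac by (metis carriers(1-3) conj_by_comp)
      qed
      ultimately have "conj_by x a \<otimes> conj_by x r \<in> H"
        using subsets(3) subgroup.m_closed[OF subgroups(4)] by blast
      moreover have "x \<in> carrier G" using x X(2) by blast
      ultimately show ?thesis
        using ac by (simp add: mem_conjugate_iff_conj_by[OF _ H_subset] conj_by_mult)
    qed
    then show ?thesis using X(3) by blast
  qed
  then have "M_sub G M E <#> R_sub G M R (E, F) \<subseteq> U" by (auto simp: set_mult_def)
  then show ?thesis using F(1) by blast
qed

end

section \<open>The four inverse limits\<close>

context semidirect_hecke_pair
begin

text \<open>The components of \<open>h\<close> are not selected separately; the description is
  unambiguous by \<open>decomposition_unique\<close>.\<close>

definition H_proj :: "'a set \<times> 'a set \<Rightarrow> 'a \<Rightarrow> 'a set \<times> 'a set" where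
  "H_proj i h = (THE c. \<exists>m\<in>M. \<exists>r\<in>R. h = m \<otimes> r \<and> c = (M_sub G M (fst i) #> m, R_sub G M R i #> r))"

lemma H_proj_mult:
  assumes "m \<in> M" "r \<in> R"
  shows "H_proj i (m \<otimes> r) = (M_sub G M (fst i) #> m, R_sub G M R i #> r)"
  unfolding H_proj_def
proof (rule the_equality)
  fix c assume "\<exists>m'\<in>M. \<exists>r'\<in>R. m \<otimes> r = m' \<otimes> r' \<and> c = (M_sub G M (fst i) #> m', R_sub G M R i #> r')"
  then obtain m' r' where *: "m' \<in> M" "r' \<in> R" "m \<otimes> r = m' \<otimes> r'"
    "c = (M_sub G M (fst i) #> m', R_sub G M R i #> r')" by blast
  then show "c = (M_sub G M (fst i) #> m, R_sub G M R i #> r)"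
    using decomposition_unique[of m m' r r'] assms subsets(1,2) by auto
qed (use assms in blast)

lemma H_cases:
  assumes "h \<in> H"
  obtains m r where "m \<in> M" "r \<in> R" "h = m \<otimes> r"
  using assms unfolding H set_mult_def by blast

text \<open>The condition \<open>q\<^sup>-\<^sup>1 M q \<subseteq> F\<close> for \<open>q \<in> E\<close> makes \<open>R\<^sup>E\<^sub>F\<close> act trivially on \<open>M/M\<^sub>E\<close>.\<close>

lemma commutator_mem_M_sub:
  assumes EF: "(E, F) \<in> \<F>" and s: "s \<in> R_sub G M R (E, F)" and m: "m \<in> M"
  shows "inv m \<otimes> conj_by (inv s) m \<in> M_sub G M E"
proof -
  note E = \<F>_D(1)[OF EF]
  have sR: "s \<in> R" and sH: "\<And>x. x \<in> E <#> F \<Longrightarrow> conj_by x s \<in> H"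
    using s by (auto simp: R_sub_eq[OF EF])
  have "inv s \<in> R" using sR subgroups(3) by (simp add: subgroup_inv_mem_iff)
  then have "conj_by (inv s) m \<in> M" using m by (simp add: conj_by_R_M_iff)
  then have aM: "inv m \<otimes> conj_by (inv s) m \<in> M"
    using m subgroups(2) by (simp add: subgroup.m_closed subgroup.m_inv_closed)
  have "conj_by q (inv m \<otimes> conj_by (inv s) m) \<in> M" if q: "q \<in> E" for q
  proof -
    have qQ: "q \<in> Q" using q \<E>_D(1)[OF E] by blast
    have n: "conj_by q m \<in> F" using \<F>_D(3)[OF EF q m] .
    have "conj_by (q \<otimes> conj_by q m) s \<in> H" using sH q n by (simp add: set_mult_memI)
    moreover have "conj_by q s \<in> H"
      using sH[OF set_mult_memI[OF q \<F>_D(4)[OF EF]]] qQ by simp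
    ultimately have "conj_by (q \<otimes> conj_by q m) s \<otimes> inv (conj_by q s) \<in> H"
      using subgroups(4) by (simp add: subgroup.m_closed subgroup.m_inv_closed)
    \<comment> \<open>Here \<open>q \<otimes> conj_by q m\<close> is just
      \<open>m \<otimes> q\<close>, so the quotient of the two conjugates of \<open>s\<close> is a
      conjugated commutator of \<open>m\<close> and \<open>s\<close>. It lies in \<open>H\<close>
      and in \<open>N\<close>, hence in \<open>M\<close>.\<close>
    also have "conj_by (q \<otimes> conj_by q m) s \<otimes> inv (conj_by q s) =
        conj_by q (inv m \<otimes> conj_by (inv s) m)"
      using qQ m sR by (simp add: conj_by_def m_assoc inv_mult_group inv_mult_cancel)
    finally show ?thesis
      using N_mem_H_iff conj_by_N[of q "inv m \<otimes> conj_by (inv s) m"] qQ aM subsets(1) by auto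
  qed
  then show ?thesis using aM by (simp add: M_sub_eq[OF E])
qed

text \<open>The union over all representatives collapses to one coset: \<open>M_sub\<close> is
  invariant under conjugation by \<open>R\<close>, and elements of \<open>R_sub\<close> act
  trivially modulo \<open>M_sub\<close>. So the action used in \<open>quot_H\<close> is well
  defined.\<close>

lemma coset_conj_eq:
  assumes EF: "(E, F) \<in> \<F>" and r: "r \<in> R" and m: "m \<in> M"
  shows "coset_conj G (R_sub G M R (E, F) #> r) (M_sub G M E #> m) = M_sub G M E #> (r \<otimes> m \<otimes> inv r)"
    (is "?L = ?K #> ?m'")
proof -
  note E = \<F>_D(1)[OF EF]
  note K = subgroup_M_sub[OF E]
  have KM: "k \<in> M" if "k \<in> ?K" for k using that M_sub_subset[OF E] by blast
  have inv_R: "inv r \<in> R" if "r \<in> R" for r using that subgroups(3) by (simp add: subgroup_inv_mem_iff)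
  have m': "?m' = conj_by (inv r) m" "?m' \<in> M"
    using conj_by_R_M_iff[OF inv_R[OF r], of m] r m by (simp_all add: conj_by_def)
  show ?thesis
  proof
    show "?L \<subseteq> ?K #> ?m'"
    proof
      fix a assume "a \<in> ?L"
      then obtain s k where s: "s \<in> R_sub G M R (E, F)" and k: "k \<in> ?K"
        and a: "a = (s \<otimes> r) \<otimes> (k \<otimes> m) \<otimes> inv (s \<otimes> r)"
        unfolding coset_conj_def r_coset_def by blast
      have sR: "s \<in> R" using s R_sub_subset[OF EF] by blast
      have sr: "s \<otimes> r \<in> R" using sR r subgroup.m_closed[OF subgroups(3)] by blast
      \<comment> \<open>Writing \<open>a = k' \<otimes> (s ?m' s^-1)\<close>, the factor
        \<open>b\<close> is \<open>s ?m' s^-1 ?m'^-1\<close>: the commutator of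
        \<open>commutator_mem_M_sub\<close>, conjugated so that \<open>?m'\<close> can stand on the
        right.\<close>
      define k' where "k' = conj_by (inv (s \<otimes> r)) k"
      define b where "b = conj_by (inv ?m') (inv ?m' \<otimes> conj_by (inv s) ?m')"
      have "inv ?m' \<in> N"
        using m'(2) subsets(1) subgroups(1) by (auto simp: subgroup_inv_mem_iff)
      then have "b \<in> ?K"
        unfolding b_def
        using conj_by_N_M_sub[OF E] commutator_mem_M_sub[OF EF s m'(2)] by blast
      moreover have "k' \<in> ?K"
        unfolding k'_def using conj_by_R_M_sub[OF E inv_R[OF sr] k] .
      ultimately have "k' \<otimes> b \<in> ?K" using subgroup.m_closed[OF K] by blast
      moreover have "a = k' \<otimes> b \<otimes> ?m'"
        using sR r m KM[OF k]
        by (simp add: a k'_def b_def conj_by_def m_assoc inv_mult_group inv_mult_cancel)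
      ultimately show "a \<in> ?K #> ?m'" unfolding r_coset_def by blast
    qed
    show "?K #> ?m' \<subseteq> ?L"
    proof
      fix a assume "a \<in> ?K #> ?m'"
      then obtain k where k: "k \<in> ?K" and a: "a = k \<otimes> ?m'" unfolding r_coset_def by blast
      have "a = (\<one> \<otimes> r) \<otimes> (conj_by r k \<otimes> m) \<otimes> inv (\<one> \<otimes> r)"
        using r m KM[OF k] by (simp add: a conj_by_def m_assoc inv_mult_cancel)
      moreover have "conj_by r k \<in> ?K" using conj_by_R_M_sub[OF E r k] .
      moreover have "\<one> \<in> R_sub G M R (E, F)" using subgroup.one_closed[OF subgroup_R_sub[OF EF]] .
      ultimately show "a \<in> ?L" unfolding coset_conj_def r_coset_def by blast
    qed
  qed
qed

lemma H_proj_hom: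
  assumes "i \<in> \<F>"
  shows "H_proj i \<in> hom (G\<lparr>carrier := H\<rparr>) (quot_H G M R i)"
    and "H_proj i ` H = carrier (quot_H G M R i)"
    and "group (quot_H G M R i)"
    and "m \<in> M \<Longrightarrow> r \<in> R \<Longrightarrow> H_proj i (m \<otimes> r) = \<one>\<^bsub>quot_H G M R i\<^esub> \<longleftrightarrow>
      m \<in> M_sub G M (fst i) \<and> r \<in> R_sub G M R i"
proof -
  obtain E F where i: "i = (E, F)" by (cases i)
  have EF: "(E, F) \<in> \<F>" using assms i by simp
  note E = \<F>_D(1)[OF EF]
  note QM = quotient_in_subgroup[OF subgroups(2) M_sub_normal(2)[OF E]]
  note QR = quotient_in_subgroup[OF subgroups(3) R_sub_normal[OF EF]]
  have car: "carrier (quot_H G M R i) = ((\<lambda>m. M_sub G M E #> m) ` M) \<times> ((\<lambda>r. R_sub G M R i #> r) ` R)"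
    using QM(3) QR(3) by (simp add: quot_H_def semidirect_product_def i)
  have one: "\<one>\<^bsub>quot_H G M R i\<^esub> = (\<one>\<^bsub>G\<lparr>carrier := M\<rparr> Mod M_sub G M E\<^esub>, \<one>\<^bsub>G\<lparr>carrier := R\<rparr> Mod R_sub G M R i\<^esub>)"
    by (simp add: quot_H_def semidirect_product_def i)
  have mem_H: "m \<in> M \<Longrightarrow> r \<in> R \<Longrightarrow> m \<otimes> r \<in> H" for m r
    unfolding H by (rule set_mult_memI)
  show onto: "H_proj i ` H = carrier (quot_H G M R i)"
  proof
    show "H_proj i ` H \<subseteq> carrier (quot_H G M R i)"
      unfolding car by (auto elim!: H_cases simp: H_proj_mult i)
    show "carrier (quot_H G M R i) \<subseteq> H_proj i ` H"
    proof
      fix c assume "c \<in> carrier (quot_H G M R i)"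
      then obtain m r where "m \<in> M" "r \<in> R" "c = (M_sub G M E #> m, R_sub G M R i #> r)"
        unfolding car by blast
      then have "c = H_proj i (m \<otimes> r)" "m \<otimes> r \<in> H" by (simp_all add: H_proj_mult i mem_H)
      then show "c \<in> H_proj i ` H" by blast
    qed
  qed
  show hom: "H_proj i \<in> hom (G\<lparr>carrier := H\<rparr>) (quot_H G M R i)"
  proof (rule homI)
    show "H_proj i h \<in> carrier (quot_H G M R i)" if "h \<in> carrier (G\<lparr>carrier := H\<rparr>)" for h
      using that onto by auto
    fix h h' assume "h \<in> carrier (G\<lparr>carrier := H\<rparr>)" "h' \<in> carrier (G\<lparr>carrier := H\<rparr>)"
    then obtain m r m' r' where h: "m \<in> M" "r \<in> R" "h = m \<otimes> r" and h': "m' \<in> M" "r' \<in> R" "h' = m' \<otimes> r'"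
      by (auto elim!: H_cases)
    have inv_r: "inv r \<in> R" using h subgroups(3) by (simp add: subgroup_inv_mem_iff)
    have rm: "r \<otimes> m' \<otimes> inv r \<in> M"
      using conj_by_R_M_iff[OF inv_r, of m'] h h' by (simp add: conj_by_def)
    \<comment> \<open>Moving \<open>r\<close> past \<open>m'\<close> is what produces the twisted
      multiplication of the semidirect product.\<close>
    have "h \<otimes> h' = (m \<otimes> (r \<otimes> m' \<otimes> inv r)) \<otimes> (r \<otimes> r')"
      using h h' by (simp add: m_assoc inv_mult_cancel)
    moreover have "m \<otimes> (r \<otimes> m' \<otimes> inv r) \<in> M" "r \<otimes> r' \<in> R"
      using h h' rm subgroup.m_closed[OF subgroups(2)] subgroup.m_closed[OF subgroups(3)] by auto
    ultimately have "H_proj i (h \<otimes> h') =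
        (M_sub G M E #> (m \<otimes> (r \<otimes> m' \<otimes> inv r)), R_sub G M R i #> (r \<otimes> r'))"
      by (simp add: H_proj_mult i)
    also have "\<dots> = ((M_sub G M E #> m) <#> (M_sub G M E #> (r \<otimes> m' \<otimes> inv r)),
        (R_sub G M R i #> r) <#> (R_sub G M R i #> r'))"
      using hom_mult[OF QM(2)] hom_mult[OF QR(2)] h h' rm by (simp add: FactGroup_def i)
    also have "\<dots> = H_proj i h \<otimes>\<^bsub>quot_H G M R i\<^esub> H_proj i h'"
      using h h' by (simp add: H_proj_mult i quot_H_def semidirect_product_def coset_conj_eq[OF EF] FactGroup_def)
    finally show "H_proj i (h \<otimes>\<^bsub>G\<lparr>carrier := H\<rparr>\<^esub> h') = H_proj i h \<otimes>\<^bsub>quot_H G M R i\<^esub> H_proj i h'" by simp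
  qed
  show ker: "H_proj i (m \<otimes> r) = \<one>\<^bsub>quot_H G M R i\<^esub> \<longleftrightarrow> m \<in> M_sub G M (fst i) \<and> r \<in> R_sub G M R i"
    if "m \<in> M" "r \<in> R" for m r
    using that QM(4) QR(4) by (simp add: H_proj_mult one[unfolded i] i)
  interpret H: group "G\<lparr>carrier := H\<rparr>" using subgroup_imp_group[OF subgroups(4)] .
  have "H_proj i \<one> = \<one>\<^bsub>quot_H G M R i\<^esub>"
    using ker[of \<one> \<one>] subgroup.one_closed[OF subgroup_M_sub[OF E]]
      subgroup.one_closed[OF subgroup_R_sub[OF EF]] by (simp add: i)
  \<comment> \<open>The group structure is inherited from \<open>H\<close> along the surjection
    \<open>H_proj i\<close>. The image group comes with updated carrier and unit, and both updates
    leave \<open>quot_H\<close> unchanged.\<close>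
  then have "quot_H G M R i\<lparr>carrier := H_proj i ` H, one := H_proj i \<one>\<rparr> = quot_H G M R i"
    using onto by simp
  then show "group (quot_H G M R i)"
    using H.hom_imp_img_group[OF hom] by simp
qed

end

section \<open>The limits over \<open>\<E>\<close> and \<open>\<F>\<close> in the completion\<close>

locale completed_semidirect_hecke_pair = semidirect_hecke_pair G N Q M R H
  for G :: "('a, 'm) monoid_scheme" (structure) and N Q M R H +
  fixes Gb :: "('b, 'n) monoid_scheme" and Tb :: "'b topology" and \<iota> :: "'a \<Rightarrow> 'b"
  assumes completion: "two_sided_completion G (hecke_topology G H) Gb Tb \<iota>"
begin

sublocale completed: two_sided_completed_group G "hecke_topology G H" Gb Tb \<iota>
  using topological_group_hecke_topology[OF subgroups(4)] completion by unfold_locales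

lemma M_sub_small:
  assumes "openin (hecke_topology G H) U" "\<one> \<in> U"
  shows "\<exists>E\<in>\<E>. M_sub G M E \<subseteq> U"
proof -
  obtain E F where EF: "(E, F) \<in> \<F>" "M_sub G M E <#> R_sub G M R (E, F) \<subseteq> U"
    using M_sub_R_sub_small[OF assms] by blast
  note E = \<F>_D(1)[OF EF(1)]
  have "m \<otimes> \<one> \<in> U" if "m \<in> M_sub G M E" for m
    using EF(2) set_mult_memI[OF that subgroup.one_closed[OF subgroup_R_sub[OF EF(1)]]] by blast
  then have "M_sub G M E \<subseteq> U" using M_sub_subset[OF E] by fastforce
  then show ?thesis using E by blast
qed

lemma \<E>_directed_le: "E \<in> \<E> \<Longrightarrow> E' \<in> \<E> \<Longrightarrow> \<exists>K\<in>\<E>. E \<le> K \<and> E' \<le> K"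
  using \<E>_directed by (intro bexI[of _ "E \<union> E'"]) auto

lemma \<F>_directed_le: "i \<in> \<F> \<Longrightarrow> j \<in> \<F> \<Longrightarrow> \<exists>k\<in>\<F>. i \<le> k \<and> j \<le> k"
  using \<F>_directed by (intro bexI[of _ "(fst i \<union> fst j, snd i \<union> snd j)"]) (auto simp: less_eq_prod_def)

theorem closure_M_iso:
  "\<exists>\<phi>. topological_group_iso
     (Gb\<lparr>carrier := Tb closure_of (\<iota> ` M)\<rparr>) (subtopology Tb (Tb closure_of (\<iota> ` M)))
     (inverse_limit \<E> (\<lambda>E. G\<lparr>carrier := M\<rparr> Mod M_sub G M E) (proj_E G M))
     (inverse_limit_topology \<E> (\<lambda>E. G\<lparr>carrier := M\<rparr> Mod M_sub G M E) (proj_E G M)) \<phi> \<and>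
   (\<forall>m\<in>M. \<phi> (\<iota> m) = (\<lambda>E\<in>\<E>. M_sub G M E #> m))"
  unfolding proj_E_def
proof (rule completed.closure_iso_inverse_limit_quotients)
  show "\<exists>U. openin (hecke_topology G H) U \<and> \<one> \<in> U \<and> M \<inter> U \<subseteq> M_sub G M E" if "E \<in> \<E>" for E
    using M_sub_open[OF that] subsets(1) by blast
qed (use subgroups M_sub_normal M_sub_antimono \<E>_directed_le M_sub_small in auto)

text \<open>The kernels are those used for \<open>M\<close>; they are normal in all of
  \<open>N\<close>, and \<open>M_sub_open\<close> bounds the trace on \<open>N\<close>.\<close>

theorem closure_N_iso:
  "\<exists>\<phi>. topological_group_iso
     (Gb\<lparr>carrier := Tb closure_of (\<iota> ` N)\<rparr>) (subtopology Tb (Tb closure_of (\<iota> ` N)))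
     (inverse_limit \<E> (\<lambda>E. G\<lparr>carrier := N\<rparr> Mod M_sub G M E) (proj_E G M))
     (inverse_limit_topology \<E> (\<lambda>E. G\<lparr>carrier := N\<rparr> Mod M_sub G M E) (proj_E G M)) \<phi> \<and>
   (\<forall>n\<in>N. \<phi> (\<iota> n) = (\<lambda>E\<in>\<E>. M_sub G M E #> n))"
  unfolding proj_E_def
  by (rule completed.closure_iso_inverse_limit_quotients)
    (use subgroups M_sub_normal M_sub_antimono \<E>_directed_le M_sub_small M_sub_open in auto)

theorem closure_R_iso:
  "\<exists>\<phi>. topological_group_iso
     (Gb\<lparr>carrier := Tb closure_of (\<iota> ` R)\<rparr>) (subtopology Tb (Tb closure_of (\<iota> ` R)))
     (inverse_limit \<F> (\<lambda>i. G\<lparr>carrier := R\<rparr> Mod R_sub G M R i) (proj_R G M R))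
     (inverse_limit_topology \<F> (\<lambda>i. G\<lparr>carrier := R\<rparr> Mod R_sub G M R i) (proj_R G M R)) \<phi> \<and>
   (\<forall>r\<in>R. \<phi> (\<iota> r) = (\<lambda>i\<in>\<F>. R_sub G M R i #> r))"
  unfolding proj_R_def
proof (rule completed.closure_iso_inverse_limit_quotients)
  show "\<exists>U. openin (hecke_topology G H) U \<and> \<one> \<in> U \<and> R \<inter> U \<subseteq> R_sub G M R i" if "i \<in> \<F>" for i
  proof (cases i)
    case (Pair E F)
    then obtain U where U: "openin (hecke_topology G H) U" "\<one> \<in> U"
      "\<forall>m\<in>M. \<forall>r\<in>R. m \<otimes> r \<in> U \<longrightarrow> m \<in> M_sub G M E \<and> r \<in> R_sub G M R (E, F)"
      using M_sub_R_sub_open[of E F] \<open>i \<in> \<F>\<close> by blast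
    \<comment> \<open>The case \<open>m = \<one>\<close>.\<close>
    then have "R \<inter> U \<subseteq> R_sub G M R i" using Pair by (force dest: bspec[of _ _ \<one>])
    then show ?thesis using U(1,2) by blast
  qed
  show "\<exists>i\<in>\<F>. R_sub G M R i \<subseteq> U" if U: "openin (hecke_topology G H) U" "\<one> \<in> U" for U
  proof -
    obtain E F where EF: "(E, F) \<in> \<F>" "M_sub G M E <#> R_sub G M R (E, F) \<subseteq> U"
      using M_sub_R_sub_small[OF U] by blast
    have "\<one> \<otimes> r \<in> U" if "r \<in> R_sub G M R (E, F)" for r
      using EF(2) that set_mult_memI[OF subgroup.one_closed[OF subgroup_M_sub[OF \<F>_D(1)[OF EF(1)]]]]
      by blast
    then have "R_sub G M R (E, F) \<subseteq> U" using R_sub_subset[OF EF(1)] by fastforce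
    then show ?thesis using EF(1) by blast
  qed
qed (use subgroups R_sub_normal R_sub_antimono \<F>_directed_le in auto)

text \<open>The general system is instantiated directly with \<open>H_proj\<close>, whose kernel is
  the product of \<open>M_sub\<close> and \<open>R_sub\<close>. \<open>M_sub_R_sub_open\<close> and
  \<open>M_sub_R_sub_small\<close> make these kernels a neighbourhood base in
  \<open>H\<close>.\<close>

theorem closure_H_iso:
  "\<exists>\<phi>. topological_group_iso
     (Gb\<lparr>carrier := Tb closure_of (\<iota> ` H)\<rparr>) (subtopology Tb (Tb closure_of (\<iota> ` H)))
     (inverse_limit \<F> (quot_H G M R) (proj_H G M R))
     (inverse_limit_topology \<F> (quot_H G M R) (proj_H G M R)) \<phi> \<and>
   (\<forall>m\<in>M. \<forall>r\<in>R. \<phi> (\<iota> (m \<otimes> r)) =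
     (\<lambda>i\<in>\<F>. (M_sub G M (fst i) #> m, R_sub G M R i #> r)))"
proof -
  interpret completed_inverse_system G "hecke_topology G H" Gb Tb \<iota> H \<F> "quot_H G M R"
    "proj_H G M R" H_proj
  proof (intro completed_inverse_system.intro completed_inverse_system_axioms.intro
      completed.two_sided_completed_group_axioms)
    show "proj_H G M R i j (H_proj j h) = H_proj i h"
      if ij: "i \<in> \<F>" "j \<in> \<F>" "i \<le> j" and h: "h \<in> H" for i j h
    proof -
      obtain m r where mr: "m \<in> M" "r \<in> R" "h = m \<otimes> r" using H_cases[OF h] .
      have E: "fst i \<in> \<E>" "fst j \<in> \<E>" "fst i \<subseteq> fst j"
        using ij \<F>_D(1)[of "fst i" "snd i"] \<F>_D(1)[of "fst j" "snd j"]
        by (auto simp: less_eq_prod_def)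
      have Rs: "subgroup (R_sub G M R k) G" if "k \<in> \<F>" for k
        using subgroup_R_sub that by (cases k) auto
      show ?thesis
        using mr
          set_mult_r_coset_absorb[OF subgroup_M_sub[OF E(1)] subgroup_M_sub[OF E(2)]
            M_sub_antimono[OF E(3)], of m]
          set_mult_r_coset_absorb[OF Rs[OF ij(1)] Rs[OF ij(2)] R_sub_antimono[OF ij], of r]
        by (simp add: H_proj_mult proj_H_def proj_E_def proj_R_def)
    qed
    show "\<exists>U. openin (hecke_topology G H) U \<and> \<one> \<in> U \<and> (\<forall>h\<in>H \<inter> U. H_proj i h = \<one>\<^bsub>quot_H G M R i\<^esub>)"
      if i: "i \<in> \<F>" for i
    proof (cases i)
      case (Pair E F)
      then obtain U where U: "openin (hecke_topology G H) U" "\<one> \<in> U"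
        "\<forall>m\<in>M. \<forall>r\<in>R. m \<otimes> r \<in> U \<longrightarrow> m \<in> M_sub G M E \<and> r \<in> R_sub G M R (E, F)"
        using M_sub_R_sub_open[of E F] i by blast
      have "H_proj i h = \<one>\<^bsub>quot_H G M R i\<^esub>" if h: "h \<in> H" "h \<in> U" for h
      proof -
        obtain m r where "m \<in> M" "r \<in> R" "h = m \<otimes> r" using H_cases[OF h(1)] .
        then show ?thesis using H_proj_hom(4)[OF i] U(3) h(2) Pair by simp
      qed
      then show ?thesis using U(1,2) by blast
    qed
    show "\<exists>i\<in>\<F>. \<forall>h\<in>H. H_proj i h = \<one>\<^bsub>quot_H G M R i\<^esub> \<longrightarrow> h \<in> U"
      if U: "openin (hecke_topology G H) U" "\<one> \<in> U" for U
    proof -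
      obtain E F where EF: "(E, F) \<in> \<F>" "M_sub G M E <#> R_sub G M R (E, F) \<subseteq> U"
        using M_sub_R_sub_small[OF U] by blast
      have "h \<in> U" if h: "h \<in> H" "H_proj (E, F) h = \<one>\<^bsub>quot_H G M R (E, F)\<^esub>" for h
      proof -
        obtain m r where "m \<in> M" "r \<in> R" "h = m \<otimes> r" using H_cases[OF h(1)] .
        then show ?thesis using H_proj_hom(4)[OF EF(1)] h(2) EF(2) set_mult_memI by fastforce
      qed
      then show ?thesis using EF(1) by blast
    qed
  qed (use subgroups H_proj_hom \<F>_directed_le in auto)
  obtain \<phi> where \<phi>: "topological_group_iso
     (Gb\<lparr>carrier := Tb closure_of (\<iota> ` H)\<rparr>) (subtopology Tb (Tb closure_of (\<iota> ` H)))
     (inverse_limit \<F> (quot_H G M R) (proj_H G M R))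
     (inverse_limit_topology \<F> (quot_H G M R) (proj_H G M R)) \<phi>"
    "\<And>h. h \<in> H \<Longrightarrow> \<phi> (\<iota> h) = (\<lambda>i\<in>\<F>. H_proj i h)"
    using closure_iso_inverse_limit by blast
  have "\<phi> (\<iota> (m \<otimes> r)) = (\<lambda>i\<in>\<F>. (M_sub G M (fst i) #> m, R_sub G M R i #> r))"
    if "m \<in> M" "r \<in> R" for m r
    using that \<phi>(2)[of "m \<otimes> r"] set_mult_memI[of m M r R] by (simp add: H H_proj_mult)
  then show ?thesis using \<phi>(1) by blast
qed

end

theorem theorem2p14:
  fixes G :: "('a, 'm) monoid_scheme" and N Q M R H :: "'a set"
    and Gb :: "('b, 'n) monoid_scheme" and Hb :: "'b set" and Tb :: "'b topology"
    and \<iota> :: "'a \<Rightarrow> 'b"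
  assumes G: "group G"
    and N: "N \<lhd> G" and Q: "subgroup Q G"
    and NQ: "N \<inter> Q = {\<one>\<^bsub>G\<^esub>}" "N <#>\<^bsub>G\<^esub> Q = carrier G"
    and M: "M \<lhd> (G\<lparr>carrier := N\<rparr>)"
    and R: "subgroup R (G\<lparr>carrier := Q\<rparr>)"
    and R_normalizes_M: "\<And>r. r \<in> R \<Longrightarrow> conjugate G r M = M"
    and H: "H = M <#>\<^bsub>G\<^esub> R"
    and hecke: "reduced_hecke_pair G H"
    and completion: "schlichting_completion G H Gb Hb Tb \<iota>"
  defines "\<E> \<equiv> E_family G Q R"
    and "\<F> \<equiv> EF_family G N Q M R"
    and "quot_M \<equiv> \<lambda>E. G\<lparr>carrier := M\<rparr> Mod M_sub G M E"
    and "quot_N \<equiv> \<lambda>E. G\<lparr>carrier := N\<rparr> Mod M_sub G M E"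
    and "quot_R \<equiv> \<lambda>i. G\<lparr>carrier := R\<rparr> Mod R_sub G M R i"
    and "Mb \<equiv> Tb closure_of (\<iota> ` M)"
    and "Nb \<equiv> Tb closure_of (\<iota> ` N)"
    and "Rb \<equiv> Tb closure_of (\<iota> ` R)"
  shows
    "(\<exists>\<phi>. topological_group_iso
            (Gb\<lparr>carrier := Mb\<rparr>) (subtopology Tb Mb)
            (inverse_limit \<E> quot_M (proj_E G M)) (inverse_limit_topology \<E> quot_M (proj_E G M)) \<phi> \<and>
          (\<forall>m\<in>M. \<phi> (\<iota> m) = (\<lambda>E\<in>\<E>. M_sub G M E #>\<^bsub>G\<^esub> m))) \<and>
     (\<exists>\<phi>. topological_group_iso
            (Gb\<lparr>carrier := Nb\<rparr>) (subtopology Tb Nb)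
            (inverse_limit \<E> quot_N (proj_E G M)) (inverse_limit_topology \<E> quot_N (proj_E G M)) \<phi> \<and>
          (\<forall>n\<in>N. \<phi> (\<iota> n) = (\<lambda>E\<in>\<E>. M_sub G M E #>\<^bsub>G\<^esub> n))) \<and>
     (\<exists>\<phi>. topological_group_iso
            (Gb\<lparr>carrier := Rb\<rparr>) (subtopology Tb Rb)
            (inverse_limit \<F> quot_R (proj_R G M R)) (inverse_limit_topology \<F> quot_R (proj_R G M R)) \<phi> \<and>
          (\<forall>r\<in>R. \<phi> (\<iota> r) = (\<lambda>i\<in>\<F>. R_sub G M R i #>\<^bsub>G\<^esub> r))) \<and>
     (\<exists>\<phi>. topological_group_iso
            (Gb\<lparr>carrier := Hb\<rparr>) (subtopology Tb Hb)
            (inverse_limit \<F> (quot_H G M R) (proj_H G M R))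
            (inverse_limit_topology \<F> (quot_H G M R) (proj_H G M R)) \<phi> \<and>
          (\<forall>m\<in>M. \<forall>r\<in>R. \<phi> (\<iota> (m \<otimes>\<^bsub>G\<^esub> r)) =
             (\<lambda>i\<in>\<F>. (M_sub G M (fst i) #>\<^bsub>G\<^esub> m, R_sub G M R i #>\<^bsub>G\<^esub> r))))"
proof -
  have Hb: "Hb = Tb closure_of (\<iota> ` H)" using completion by (simp add: schlichting_completion_def)
  interpret completed_semidirect_hecke_pair G N Q M R H Gb Tb \<iota>
    using assms(1-9) hecke completion
    by (simp add: completed_semidirect_hecke_pair_def completed_semidirect_hecke_pair_axioms_def
        semidirect_hecke_pair_def semidirect_hecke_pair_axioms_def
        reduced_hecke_pair_def schlichting_completion_def)
  show ?thesis
    unfolding \<E>_def \<F>_def quot_M_def quot_N_def quot_R_def Mb_def Nb_def Rb_def Hb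
    using closure_M_iso closure_N_iso closure_R_iso closure_H_iso by (intro conjI)
qed

end
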